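(* Consider the quadratic measurement model $y_i=\boldsymbol\beta^{\star\top}\boldsymbol Z_i\boldsymbol\beta^\star+\varepsilon_i$, $i=1,\dots,n$, with true parameter $\boldsymbol\beta^\star\in\mathbb R^d$, support $\Gamma^\star$ of size $s$, and let $\lambda_n>0$. Suppose the standing conditions and Assumptions 1, 2, 3 and 4 listed in the context hold. Put $$C_0=\max\Big\{\frac{10\sigma\sqrt{c_4}}{c_1c_3},\frac{4}{c_1^2c_3}\Big\},\qquad r_n=C_0\Big(\sqrt{\tfrac{\ln(1+2n)}{n}}+\tfrac{\lambda_n\varrho}{\sqrt s}\Big),\qquad p_1=2\exp\{-s\ln(1+2n)\},\qquad p_2=n^{-n/2}.$$ Suppose that the triple $(n,s,d)$ satisfies $$36c_2^2c_5C_0s^2\le\sqrt n,\qquad \sqrt{\frac{2\ln(1+2n)}{n}}\le c_2C_0^{-1},\qquad \frac{3}{\sqrt{ns}}\le c_2,$$ and $$\max\Big\{\sqrt{\frac{s\ln(1+2n)}{n}},\ 6\sqrt2\,c_2\sigma s\sqrt{\frac{s\ln(1+2n)+\ln d}{n}}\Big\}\le\lambda_n\varrho\le\frac{c_2\sqrt s}{\sqrt2\,C_0}.$$ Then, for any $\mu\le c_1^2c_3s$ (where $\mu$ is the weak convexity parameter in Assumption 1) and $$2(4c_3+3c_4)c_2r_n+10\sigma\sqrt{c_4}\sqrt{\frac{\ln(1+2n)}{n}}\le c_1^2c_3\sqrt s,$$ there exists a local minimizer $\hat{\boldsymbol\beta}$ of the problem $$\min_{\boldsymbol\beta\in\mathbb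 R^d}\ \frac1{4n}\sum_{i=1}^n\big(\boldsymbol\beta^\top\boldsymbol Z_i\boldsymbol\beta-y_i\big)^2+P_{\lambda_n}(\boldsymbol\beta)$$ such that (i) $\mathbb P\big(\hat{\boldsymbol\beta}_{\Gamma^{\star c}}=\boldsymbol 0\big)\ge1-p_1-2p_2-\frac2n$; and (ii) $\mathbb P\big(\min\{\|\hat{\boldsymbol\beta}+\boldsymbol\beta^\star\|,\|\hat{\boldsymbol\beta}-\boldsymbol\beta^\star\|\}\le r_n\big)\ge1-p_1-2p_2-\frac2n$.
   Context: Notation. $\|\cdot\|$ is the Euclidean norm. For a matrix $\boldsymbol Z$, $|\boldsymbol Z|_\infty$ is the maximum absolute value of its entries. $\boldsymbol Z^{\Gamma_1\Gamma_2}$ is the submatrix with rows indexed by $\Gamma_1$ and columns indexed by $\Gamma_2$; $\boldsymbol\beta_\Gamma$ is the subvector indexed by $\Gamma$; $\Gamma^{\star c}=\{1,\dots,d\}\setminus\Gamma^\star$; $\otimes$ is the Kronecker product. Model. $\boldsymbol Z_1,\dots,\boldsymbol Z_n\in\mathbb R^{d\times d}$ are symmetric design matrices, $\boldsymbol\beta^\star\in\mathbb R^d$ is the true parameter, $\Gamma^\star=\{j:\beta^\star_j\ne0\}$, $s=|\Gamma^\star|$ is the number of nonzero entries of $\boldsymbol\beta^\star$, $y_i\in\mathbb R$ are the observed responses and $\varepsilon_i\in\mathbb R$ are random errors. Standing conditions. (a) High-dimensional setting: $d$ is larger than $n$, and $\ln d=o(n^\alpha)$ for some constant $\alpha\in(0,1)$.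 (b) There are constants $0<c_1\le c_2<\infty$ with $c_1\le|\beta_j^\star|\le c_2$ for all $j\in\Gamma^\star$. (c) The responses and design matrices are standardized so that $\sum_{i=1}^n y_i=0$ and $\sum_{i=1}^n|\boldsymbol Z_i|_\infty^2=n$. Assumption 1 (weakly convex-concave penalty). The penalty is $P_{\lambda_n}(\boldsymbol\beta)=\sum_{j=1}^d p_{\lambda_n}(|\beta_j|)$ with a scalar function $p_{\lambda_n}$ such that: (i) $p_{\lambda_n}$ is concave on $(0,\infty)$ and there is $\mu>0$ such that $p_{\lambda_n}(t)+\frac\mu2t^2$ is convex; (ii) $p_{\lambda_n}(0)=0$ and $p_{\lambda_n}(t)>0$ for $t>0$; (iii) for $t>0$, $p_{\lambda_n}$ is non-decreasing and $t\mapsto p_{\lambda_n}(t)/t$ is non-increasing; (iv) $p_{\lambda_n}$ is differentiable with derivative $p'_{\lambda_n}$ for all $t>0$ and subdifferentiable at $t=0$, with $\lim_{t\to0^+}p'_{\lambda_n}(t)=\lambda_n\varrho$, $\varrho>0$, and $p'_{\lambda_n}$ is locally Lipschitz continuous on $(0,\infty)$. Assumption 2. $\varepsilon_1,\dots,\varepsilon_n$ are independent and identically distributed sub-Gaussian with variance proxy $\sigma^2$ (i.e. $\mathbb E e^{t\varepsilon_i}\le e^{\sigma^2t^2/2}$ for all $t\in\mathbb R$), and each $\varepsilon_i$ has zero mean and positive variance. Assumption 3. There are constants $c_4\ge c_3>0$ such that for all $\boldsymbol x,\boldsymbol y\in\mathbb R^s$, $c_3\|\boldsymbol x\|^2\|\boldsymbol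 y\|^2\le\frac1n\sum_{i=1}^n(\boldsymbol x^\top\boldsymbol Z_i^{\Gamma^\star\Gamma^\star}\boldsymbol y)^2\le c_4\|\boldsymbol x\|^2\|\boldsymbol y\|^2$. Assumption 4. There is a constant $c_5>0$ such that $\big|\sum_{i=1}^n\boldsymbol Z_i^{\Gamma^\star\Gamma^\star}\otimes\boldsymbol Z_i^{\Gamma^{\star c}\Gamma^{\star c}}\big|_\infty\le c_5\sqrt n$ and $\big|\sum_{i=1}^n\boldsymbol Z_i^{\Gamma^\star\Gamma^\star}\otimes\boldsymbol Z_i^{\Gamma^{\star c}\Gamma^\star}\big|_\infty\le c_5\sqrt n$. *)

theory Defs
  imports "HOL-Probability.Probability" "HOL-Library.Landau_Symbols"
begin

subsection \<open>Matrices and vectors\<close>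

definition support :: "real ^ 'd \<Rightarrow> 'd set" where
  "support x = {j. x $ j \<noteq> 0}"

definition max_abs_entry :: "real ^ 'c ^ 'r \<Rightarrow> real" where
  "max_abs_entry A = Max {\<bar>A $ j $ k\<bar> | j k. True}"

text \<open>The submatrix with rows in \<open>G1\<close> and columns in \<open>G2\<close> keeps the format of \<open>A\<close> and is padded with
  zeros. The padding affects neither the largest absolute entry (of sums of Kronecker products) nor
  the bilinear form on vectors supported in \<open>G1\<close> and \<open>G2\<close>. The latter vectors, with the norm of the
  ambient space, are the Euclidean spaces of dimensions \<open>card G1\<close> and \<open>card G2\<close>.\<close>

definition submatrix :: "'r set \<Rightarrow> 'c set \<Rightarrow> real ^ 'c ^ 'r \<Rightarrow> real ^ 'c ^ 'r" where
  "submatrix G1 G2 A = (\<chi> j k. if j \<in> G1 \<and> k \<in> G2 then A $ j $ k else 0)"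

definition kronecker ::
    "real ^ 'c1 ^ 'r1 \<Rightarrow> real ^ 'c2 ^ 'r2 \<Rightarrow> real ^ ('c1 \<times> 'c2) ^ ('r1 \<times> 'r2)" where
  "kronecker A B = (\<chi> r c. A $ fst r $ fst c * B $ snd r $ snd c)"


subsection \<open>The penalized least squares problem\<close>

definition penalty :: "(real \<Rightarrow> real) \<Rightarrow> real ^ 'd \<Rightarrow> real" where
  "penalty p \<beta> = (\<Sum>j\<in>UNIV. p \<bar>\<beta> $ j\<bar>)"

definition objective ::
    "nat \<Rightarrow> (nat \<Rightarrow> real ^ 'd ^ 'd) \<Rightarrow> (nat \<Rightarrow> real) \<Rightarrow> (real \<Rightarrow> real) \<Rightarrow> real ^ 'd \<Rightarrow> real" where
  "objective n Z y p \<beta> =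
     1 / (4 * real n) * (\<Sum>i=1..n. (\<beta> \<bullet> (Z i *v \<beta>) - y i)\<^sup>2) + penalty p \<beta>"

definition local_minimizer :: "('v::metric_space \<Rightarrow> real) \<Rightarrow> 'v \<Rightarrow> bool" where
  "local_minimizer f x \<longleftrightarrow> (\<exists>e>0. \<forall>z\<in>ball x e. f x \<le> f z)"


subsection \<open>Standing conditions\<close>

definition high_dimensional :: "(nat \<Rightarrow> nat) \<Rightarrow> bool" where
  "high_dimensional ds \<longleftrightarrow> (\<forall>n. n < ds n) \<and>
     (\<exists>\<alpha>. 0 < \<alpha> \<and> \<alpha> < 1 \<and> (\<lambda>n. ln (real (ds n))) \<in> o(\<lambda>n. real n powr \<alpha>))"

definition signal_bounds :: "real ^ 'd \<Rightarrow> real \<Rightarrow> real \<Rightarrow> bool" where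
  "signal_bounds \<beta> c1 c2 \<longleftrightarrow> 0 < c1 \<and> c1 \<le> c2 \<and>
     (\<forall>j\<in>support \<beta>. c1 \<le> \<bar>\<beta> $ j\<bar> \<and> \<bar>\<beta> $ j\<bar> \<le> c2)"

definition standardized :: "nat \<Rightarrow> (nat \<Rightarrow> real ^ 'd ^ 'd) \<Rightarrow> (nat \<Rightarrow> real) \<Rightarrow> bool" where
  "standardized n Z y \<longleftrightarrow>
     (\<Sum>i=1..n. y i) = 0 \<and> (\<Sum>i=1..n. (max_abs_entry (Z i))\<^sup>2) = real n"


subsection \<open>Weakly convex-concave penalties\<close>

text \<open>Nonemptiness of the regular (Frechet) subdifferential of \<open>f\<close>, as a function on \<open>S\<close>.\<close>

definition subdifferentiable_within :: "(real \<Rightarrow> real) \<Rightarrow> real \<Rightarrow> real set \<Rightarrow> bool" where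
  "subdifferentiable_within f x S \<longleftrightarrow>
     (\<exists>v. \<forall>e>0. \<forall>\<^sub>F t in at x within S. f t \<ge> f x + v * (t - x) - e * \<bar>t - x\<bar>)"

text \<open>The domain of the scalar penalty is \<open>{0..}\<close>; its values at negative reals play no role.\<close>

definition weakly_convex_concave :: "(real \<Rightarrow> real) \<Rightarrow> real \<Rightarrow> real \<Rightarrow> real \<Rightarrow> bool" where
  "weakly_convex_concave p \<mu> lam rho \<longleftrightarrow>
     concave_on {0<..} p \<and> 0 < \<mu> \<and> convex_on {0..} (\<lambda>t. p t + \<mu> / 2 * t\<^sup>2) \<and>
     p 0 = 0 \<and> (\<forall>t>0. 0 < p t) \<and>
     mono_on {0<..} p \<and> antimono_on {0<..} (\<lambda>t. p t / t) \<and>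
     (\<forall>t>0. p differentiable (at t)) \<and>
     subdifferentiable_within p 0 {0..} \<and>
     0 < rho \<and> (deriv p \<longlongrightarrow> lam * rho) (at_right 0) \<and>
     (\<forall>t>0. \<exists>e>0. \<exists>L. L-lipschitz_on (ball t e \<inter> {0<..}) (deriv p))"


subsection \<open>Errors and design\<close>

definition subgaussian :: "'a measure \<Rightarrow> real \<Rightarrow> ('a \<Rightarrow> real) \<Rightarrow> bool" where
  "subgaussian M \<sigma> X \<longleftrightarrow>
     (\<forall>t. integrable M (\<lambda>\<omega>. exp (t * X \<omega>)) \<and>
          (\<integral>\<omega>. exp (t * X \<omega>) \<partial>M) \<le> exp (\<sigma>\<^sup>2 * t\<^sup>2 / 2))"

definition iid_subgaussian_errors ::
    "'a measure \<Rightarrow> nat \<Rightarrow> real \<Rightarrow> (nat \<Rightarrow> 'a \<Rightarrow> real) \<Rightarrow> bool" where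
  "iid_subgaussian_errors M n \<sigma> \<epsilon> \<longleftrightarrow>
     prob_space.indep_vars M (\<lambda>_. borel) \<epsilon> {1..n} \<and>
     (\<forall>i\<in>{1..n}. \<forall>j\<in>{1..n}. distr M borel (\<epsilon> i) = distr M borel (\<epsilon> j)) \<and>
     (\<forall>i\<in>{1..n}. subgaussian M \<sigma> (\<epsilon> i) \<and>
        prob_space.expectation M (\<epsilon> i) = 0 \<and> prob_space.variance M (\<epsilon> i) > 0)"

definition restricted_isometry ::
    "nat \<Rightarrow> (nat \<Rightarrow> real ^ 'd ^ 'd) \<Rightarrow> 'd set \<Rightarrow> real \<Rightarrow> real \<Rightarrow> bool" where
  "restricted_isometry n Z G c3 c4 \<longleftrightarrow> 0 < c3 \<and> c3 \<le> c4 \<and>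
     (\<forall>u v. support u \<subseteq> G \<longrightarrow> support v \<subseteq> G \<longrightarrow>
        c3 * (norm u)\<^sup>2 * (norm v)\<^sup>2 \<le> 1 / real n * (\<Sum>i=1..n. (u \<bullet> (submatrix G G (Z i) *v v))\<^sup>2) \<and>
        1 / real n * (\<Sum>i=1..n. (u \<bullet> (submatrix G G (Z i) *v v))\<^sup>2) \<le> c4 * (norm u)\<^sup>2 * (norm v)\<^sup>2)"

definition low_cross_correlation ::
    "nat \<Rightarrow> (nat \<Rightarrow> real ^ 'd ^ 'd) \<Rightarrow> 'd set \<Rightarrow> real \<Rightarrow> bool" where
  "low_cross_correlation n Z G c5 \<longleftrightarrow> 0 < c5 \<and>
     max_abs_entry (\<Sum>i=1..n. kronecker (submatrix G G (Z i)) (submatrix (- G) (- G) (Z i)))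
       \<le> c5 * sqrt (real n) \<and>
     max_abs_entry (\<Sum>i=1..n. kronecker (submatrix G G (Z i)) (submatrix (- G) G (Z i)))
       \<le> c5 * sqrt (real n)"

end

theory Submission
  imports Defs
begin

text \<open>
  Expanding the squares shows that, up to a constant, the objective is
  \<open>1 / (4 * n) * (\<Sum>i. (\<beta> \<bullet> (Z i *v \<beta>) - \<beta>s \<bullet> (Z i *v \<beta>s))\<^sup>2) - 1 / 2 * (\<beta> \<bullet> (A *v \<beta>)) + penalty p \<beta>\<close>,
  so the errors act only through the matrix \<open>A = (1 / n) * (\<Sum>i. \<epsilon> i * Z i)\<close>. The proof separates what is
  true for every small \<open>A\<close> from the probability that \<open>A\<close> is small. Here \<open>A\<close> is small if its quadratic
  form is bounded on the vectors supported in \<open>\<Gamma>\<close> and all its entries are bounded.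

  For small \<open>A\<close>, consider the objective on the vectors that are supported in \<open>\<Gamma>\<close> and at distance at most
  \<open>r\<close> from \<open>\<beta>s\<close>. Since \<open>\<beta> \<bullet> (Z i *v \<beta>) - \<beta>s \<bullet> (Z i *v \<beta>s) = (\<beta> - \<beta>s) \<bullet> (Z i *v (\<beta> + \<beta>s))\<close>, the restricted
  isometry makes the noise-free loss grow like \<open>c3 / 4 * norm (\<beta> - \<beta>s)\<^sup>2 * norm (\<beta> + \<beta>s)\<^sup>2\<close>. The radius
  \<open>r\<close> is chosen so that on the sphere this outweighs both the noise and the change of the penalty
  (\<open>contrast_excess\<close>), hence a minimizer over the ball lies in its interior. The loss is moreover so
  strongly convex on the ball that the weakly convex penalty cannot destroy strict convexity
  (\<open>contrast_midpoint\<close>), hence the minimizer is unique. At this point the partial derivatives of the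
  loss outside \<open>\<Gamma>\<close> are smaller than \<open>lam * rho\<close>, by the small cross-correlations and the small entries
  of \<open>A\<close> (\<open>contrast_grad_off_support\<close>). As \<open>lam * rho\<close> is the slope of the penalty at the origin,
  activating further coordinates increases the objective, and the restricted minimizer is a local
  minimizer of the full problem (\<open>local_minimizer_of_restricted\<close>).

  Being unique, the minimizer depends continuously on \<open>A\<close> (\<open>continuous_on_unique_argmin\<close>), so composing
  it with the random matrix gives a measurable estimator. When \<open>A\<close> is not small the estimator is set
  to the origin, which is a local minimizer for every outcome (\<open>local_minimizer_zero\<close>). The estimator is
  thus supported in \<open>\<Gamma>\<close> for every outcome, and it is within \<open>r\<close> of \<open>\<beta>s\<close> whenever \<open>A\<close> is small.

  The smallness of \<open>A\<close> is a union bound over sub-Gaussian tails (\<open>good_noise_probability\<close>). The quadratic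
  form is controlled on a \<open>1 / 4\<close>-net of the unit ball with at most \<open>9 ^ card \<Gamma>\<close> points, which costs at
  most \<open>p1\<close>; the entries cost at most \<open>2 / n\<close>.
\<close>

section \<open>Weakly convex-concave penalties\<close>

context
  fixes p :: "real \<Rightarrow> real" and \<mu> lam rho :: real
  assumes pen: "weakly_convex_concave p \<mu> lam rho"
begin

lemma penalty_zero [simp]: "p 0 = 0"
  using pen unfolding weakly_convex_concave_def by blast

lemma penalty_pos: "0 < t \<Longrightarrow> 0 < p t"
  using pen unfolding weakly_convex_concave_def by blast

lemma penalty_mono:
  assumes "0 \<le> a" "a \<le> b" shows "p a \<le> p b"
proof (cases "a = 0")
  case True
  then show ?thesis using penalty_pos[of b] assms by (cases "b = 0") auto
next
  case False
  have "mono_on {0<..} p" using pen unfolding weakly_convex_concave_def by blast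
  from mono_onD[OF this, of a b] show ?thesis using assms False by simp
qed

lemma penalty_ratio_antimono:
  assumes "0 < a" "a \<le> b" shows "p b / b \<le> p a / a"
proof -
  have "antimono_on {0<..} (\<lambda>t. p t / t)" using pen unfolding weakly_convex_concave_def by blast
  from monotone_onD[OF this, of a b] show ?thesis using assms by simp
qed

text \<open>Convexity of \<open>p t + \<mu> / 2 * t\<^sup>2\<close> bounds this function by its chord over \<open>{0..1}\<close>. This excludes a
  jump of \<open>p\<close> at the origin.\<close>

lemma penalty_tendsto_zero: "(p \<longlongrightarrow> 0) (at_right 0)"
proof (rule tendsto_sandwich)
  have cvx: "convex_on {0..} (\<lambda>t. p t + \<mu> / 2 * t\<^sup>2)" and mu: "0 < \<mu>"
    using pen unfolding weakly_convex_concave_def by blast+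
  show "\<forall>\<^sub>F t in at_right 0. 0 \<le> p t"
    by (rule eventually_mono[OF eventually_at_right_less]) (use penalty_pos in \<open>auto intro: less_imp_le\<close>)
  show "\<forall>\<^sub>F t in at_right 0. p t \<le> t * (p 1 + \<mu> / 2)"
  proof -
    have "p t \<le> t * (p 1 + \<mu> / 2)" if "0 < t" "t < 1" for t
    proof -
      have "p t + \<mu> / 2 * t\<^sup>2 \<le> t * (p 1 + \<mu> / 2)"
        using convex_onD[OF cvx, of t 0 1] that by simp
      moreover have "0 \<le> \<mu> / 2 * t\<^sup>2" using mu by simp
      ultimately show ?thesis by linarith
    qed
    then show ?thesis by (auto simp: eventually_at_right_field intro!: exI[of _ 1])
  qed
  show "((\<lambda>t. t * (p 1 + \<mu> / 2)) \<longlongrightarrow> 0) (at_right 0)"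
    by (auto intro!: tendsto_eq_intros)
qed auto

text \<open>The one-sided derivative at the origin, obtained from the limit of the derivatives by l'Hopital's
  rule.\<close>

lemma penalty_ratio_tendsto: "((\<lambda>t. p t / t) \<longlongrightarrow> lam * rho) (at_right 0)"
proof -
  have diff: "\<And>t. t > 0 \<Longrightarrow> (p has_real_derivative deriv p t) (at t)"
    using pen unfolding weakly_convex_concave_def DERIV_deriv_iff_real_differentiable by blast
  have lim: "(deriv p \<longlongrightarrow> lam * rho) (at_right 0)"
    using pen unfolding weakly_convex_concave_def by blast
  show ?thesis
  proof (rule lhopital_right_0[where f' = "deriv p" and g' = "\<lambda>_. 1"])
    show "(p \<longlongrightarrow> 0) (at_right 0)" by (rule penalty_tendsto_zero)
    show "((\<lambda>x. x) \<longlongrightarrow> (0::real)) (at_right 0)" by (auto intro!: tendsto_eq_intros)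
    show "\<forall>\<^sub>F x in at_right 0. (p has_real_derivative deriv p x) (at x)"
      by (rule eventually_mono[OF eventually_at_right_less]) (use diff in auto)
    show "\<forall>\<^sub>F x::real in at_right 0. x \<noteq> 0"
      by (rule eventually_mono[OF eventually_at_right_less]) auto
  qed (use lim in \<open>auto intro!: derivative_eq_intros\<close>)
qed

lemma penalty_le_linear:
  assumes "0 \<le> t" shows "p t \<le> lam * rho * t"
proof (cases "t = 0")
  case False
  with assms have t: "0 < t" by simp
  have "\<forall>\<^sub>F u in at_right 0. p t / t \<le> p u / u"
    using t by (auto simp: eventually_at_right_field intro!: exI[of _ t] penalty_ratio_antimono)
  then have "p t / t \<le> lam * rho"
    by (intro tendsto_lowerbound[OF penalty_ratio_tendsto]) auto
  then show ?thesis using t by (simp add: field_simps)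
qed simp

lemma penalty_ge_linear_near_zero:
  assumes "c < lam * rho"
  shows "\<exists>e>0. \<forall>t. 0 \<le> t \<longrightarrow> t < e \<longrightarrow> c * t \<le> p t"
proof -
  have "\<forall>\<^sub>F t in at_right 0. c < p t / t"
    using order_tendstoD(1)[OF penalty_ratio_tendsto assms] .
  then obtain e where e: "e > 0" "\<And>t. 0 < t \<Longrightarrow> t < e \<Longrightarrow> c < p t / t"
    by (auto simp: eventually_at_right_field)
  have "c * t \<le> p t" if "0 \<le> t" "t < e" for t
    using e(2)[of t] that by (cases "t = 0") (auto simp: field_simps)
  then show ?thesis using e(1) by blast
qed

text \<open>Since \<open>p t / t\<close> is non-increasing, \<open>p\<close> is subadditive; the slope at the origin then bounds all
  increments.\<close>

lemma penalty_increment_le: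
  assumes "0 \<le> a" "0 \<le> b" shows "p a - p b \<le> lam * rho * \<bar>a - b\<bar>"
proof (cases "a \<le> b")
  case True
  then have "p a \<le> p b" using assms penalty_mono by blast
  moreover have "0 \<le> lam * rho * \<bar>a - b\<bar>"
    using penalty_le_linear[of "\<bar>a - b\<bar>"] penalty_mono[of 0 "\<bar>a - b\<bar>"] by simp
  ultimately show ?thesis by linarith
next
  case False
  define h where "h = a - b"
  have h: "0 < h" "a = b + h" using False by (auto simp: h_def)
  have "p (b + h) \<le> p b + p h"
  proof (cases "b = 0")
    case False
    with assms have b: "0 < b" by simp
    have "p (b + h) = b * (p (b + h) / (b + h)) + h * (p (b + h) / (b + h))"
      using b h by (simp flip: distrib_right add_divide_distrib)
    also have "\<dots> \<le> b * (p b / b) + h * (p h / h)"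
      using b h by (intro add_mono mult_left_mono penalty_ratio_antimono) auto
    finally show ?thesis using b h by simp
  qed simp
  then show ?thesis using penalty_le_linear[of h] h by simp
qed

lemma penalty_lipschitz:
  assumes "0 \<le> a" "0 \<le> b" shows "\<bar>p a - p b\<bar> \<le> lam * rho * \<bar>a - b\<bar>"
  using penalty_increment_le[OF assms] penalty_increment_le[OF assms(2,1)]
  by (simp add: abs_le_iff abs_minus_commute)

lemma lam_rho_nonneg: "0 \<le> lam * rho"
  using penalty_le_linear[of 1] penalty_mono[of 0 1] by simp

lemma penalty_vec_increment_le:
  fixes x z :: "real ^ 'd"
  shows "penalty p x - penalty p z \<le> lam * rho * (\<Sum>j\<in>UNIV. \<bar>x $ j - z $ j\<bar>)"
proof -
  have "penalty p x - penalty p z = (\<Sum>j\<in>UNIV. p \<bar>x $ j\<bar> - p \<bar>z $ j\<bar>)"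
    by (simp add: penalty_def sum_subtractf)
  also have "\<dots> \<le> (\<Sum>j\<in>UNIV. lam * rho * \<bar>x $ j - z $ j\<bar>)"
  proof (rule sum_mono)
    fix j
    have "p \<bar>x $ j\<bar> - p \<bar>z $ j\<bar> \<le> lam * rho * \<bar>\<bar>x $ j\<bar> - \<bar>z $ j\<bar>\<bar>"
      by (rule penalty_increment_le) auto
    also have "\<dots> \<le> lam * rho * \<bar>x $ j - z $ j\<bar>"
      by (intro mult_left_mono lam_rho_nonneg) auto
    finally show "p \<bar>x $ j\<bar> - p \<bar>z $ j\<bar> \<le> lam * rho * \<bar>x $ j - z $ j\<bar>" .
  qed
  finally show ?thesis by (simp add: sum_distrib_left)
qed

lemma continuous_on_penalty: "continuous_on UNIV (penalty p :: real ^ 'd \<Rightarrow> real)"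
proof -
  have "continuous_on {0..} p"
    by (rule lipschitz_on_continuous_on[of "lam * rho"])
       (auto simp: lipschitz_on_def dist_real_def lam_rho_nonneg penalty_lipschitz)
  then have "continuous_on UNIV (\<lambda>x :: real ^ 'd. p \<bar>x $ j\<bar>)" for j
    by (rule continuous_on_compose2) (auto intro!: continuous_intros)
  then show ?thesis unfolding penalty_def by (intro continuous_on_sum) auto
qed

text \<open>The function \<open>p t + \<mu> / 2 * t\<^sup>2\<close> is convex and non-decreasing on \<open>{0..}\<close>, so its even extension is
  convex on the whole line.\<close>

lemma penalty_midpoint:
  fixes a e :: "real ^ 'd"
  shows "2 * penalty p a \<le> penalty p (a + e) + penalty p (a - e) + \<mu> * (norm e)\<^sup>2"
proof -
  define \<phi> where "\<phi> t = p \<bar>t\<bar> + \<mu> / 2 * t\<^sup>2" for t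
  have cvx: "convex_on {0..} (\<lambda>t. p t + \<mu> / 2 * t\<^sup>2)" and mu: "0 < \<mu>"
    using pen unfolding weakly_convex_concave_def by blast+
  have \<phi>_abs: "\<phi> \<bar>t\<bar> = \<phi> t" for t by (simp add: \<phi>_def)
  have \<phi>_mono: "\<phi> s \<le> \<phi> t" if "0 \<le> s" "s \<le> t" for s t
    unfolding \<phi>_def using that mu penalty_mono[of s t] by (intro add_mono mult_left_mono power_mono) auto
  have scalar: "2 * p \<bar>u\<bar> \<le> p \<bar>u + v\<bar> + p \<bar>u - v\<bar> + \<mu> * v\<^sup>2" for u v
  proof -
    have "\<phi> u \<le> \<phi> ((1 - 1/2) * \<bar>u + v\<bar> + 1/2 * \<bar>u - v\<bar>)"
      unfolding \<phi>_abs[of u, symmetric] by (intro \<phi>_mono) (auto simp: abs_if field_simps)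
    also have "\<dots> \<le> (1 - 1/2) * \<phi> \<bar>u + v\<bar> + 1/2 * \<phi> \<bar>u - v\<bar>"
      using convex_onD[OF cvx, of "1/2" "\<bar>u + v\<bar>" "\<bar>u - v\<bar>"] by (simp add: \<phi>_def)
    finally have "2 * \<phi> u \<le> \<phi> (u + v) + \<phi> (u - v)" by (simp add: \<phi>_abs)
    then show ?thesis by (simp add: \<phi>_def power2_eq_square algebra_simps)
  qed
  have "2 * penalty p a \<le> (\<Sum>j\<in>UNIV. p \<bar>a $ j + e $ j\<bar> + p \<bar>a $ j - e $ j\<bar> + \<mu> * (e $ j)\<^sup>2)"
    unfolding penalty_def sum_distrib_left by (intro sum_mono scalar)
  also have "\<dots> = penalty p (a + e) + penalty p (a - e) + \<mu> * (norm e)\<^sup>2"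
    by (simp add: penalty_def sum.distrib sum_distrib_left power2_norm_eq_inner inner_vec_def flip: sum_distrib_left)
       (simp add: power2_eq_square)
  finally show ?thesis .
qed

text \<open>Near the origin the penalty grows at rate \<open>lam * rho\<close>. Hence switching on a coordinate outside
  \<open>G\<close> costs more than a smooth loss can gain from it, as long as the partial derivative of the loss
  in that coordinate is smaller than this rate. The comparison within \<open>G\<close> then decides.\<close>

lemma local_minimizer_of_restricted:
  fixes f :: "real ^ 'd \<Rightarrow> real" and g :: "real ^ 'd \<Rightarrow> real ^ 'd"
  assumes der: "\<And>x. (f has_derivative (\<lambda>h. g x \<bullet> h)) (at x)"
    and cont: "continuous_on UNIV g"
    and b: "support b \<subseteq> G" and e: "0 < e"
    and restr: "\<And>z. support z \<subseteq> G \<Longrightarrow> dist b z < e \<Longrightarrow> f b + penalty p b \<le> f z + penalty p z"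
    and grad: "\<And>j. j \<notin> G \<Longrightarrow> \<bar>g b $ j\<bar> < lam * rho"
    and lr: "0 < lam * rho"
  shows "local_minimizer (\<lambda>x. f x + penalty p x) b"
proof -
  define M where "M = Max (insert 0 ((\<lambda>j. \<bar>g b $ j\<bar>) ` (- G)))"
  \<comment> \<open>A rate \<open>c\<close> strictly between the partial derivatives and the slope still separates them at all
     points near \<open>b\<close>.\<close>
  have "M < lam * rho" unfolding M_def using grad lr by (subst Max_less_iff) auto
  then obtain c where c: "M < c" "c < lam * rho" using dense by blast
  have gc: "\<bar>g b $ j\<bar> < c" if "j \<notin> G" for j
    using c(1) that unfolding M_def by (subst (asm) Max_less_iff) auto
  have "\<forall>\<^sub>F x in nhds b. \<forall>j\<in>-G. \<bar>g x $ j\<bar> < c"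
  proof (rule eventually_ball_finite; clarify?)
    fix j assume "j \<notin> G"
    have "isCont (\<lambda>x. \<bar>g x $ j\<bar>) b"
      using cont by (intro continuous_intros) (simp add: continuous_on_eq_continuous_at)
    then have "((\<lambda>x. \<bar>g x $ j\<bar>) \<longlongrightarrow> \<bar>g b $ j\<bar>) (nhds b)"
      unfolding isCont_def tendsto_at_iff_tendsto_nhds[of "\<lambda>x. \<bar>g x $ j\<bar>" b] .
    then show "\<forall>\<^sub>F x in nhds b. \<bar>g x $ j\<bar> < c"
      using gc[OF \<open>j \<notin> G\<close>] by (rule order_tendstoD(2))
  qed simp
  then obtain e1 where e1: "e1 > 0" "\<And>x j. dist x b < e1 \<Longrightarrow> j \<notin> G \<Longrightarrow> \<bar>g x $ j\<bar> < c"
    unfolding eventually_nhds_metric by blast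
  obtain e2 where e2: "e2 > 0" "\<And>t. 0 \<le> t \<Longrightarrow> t < e2 \<Longrightarrow> c * t \<le> p t"
    using penalty_ge_linear_near_zero[OF c(2)] by blast
  define e0 where "e0 = min e (min e1 e2)"
  have "f b + penalty p b \<le> f z + penalty p z" if z: "z \<in> ball b e0" for z
  proof -
    \<comment> \<open>Move from \<open>b\<close> to \<open>z\<close> first within \<open>G\<close>, to \<open>u\<close>, and then along the other coordinates \<open>\<delta>\<close>.\<close>
    define u where "u = (\<chi> j. if j \<in> G then z $ j else 0)"
    define \<delta> where "\<delta> = z - u"
    have \<delta>: "\<delta> $ j = (if j \<in> G then 0 else z $ j)" for j by (simp add: \<delta>_def u_def)
    have bj: "j \<notin> G \<Longrightarrow> b $ j = 0" for j using b by (auto simp: support_def)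
    have near: "dist b (u + t *\<^sub>R \<delta>) < e0" if "0 \<le> t" "t \<le> 1" for t
    proof -
      have "norm (b - (u + t *\<^sub>R \<delta>)) \<le> norm (b - z)"
      proof (rule norm_le_componentwise_cart)
        fix i show "norm ((b - (u + t *\<^sub>R \<delta>)) $ i) \<le> norm ((b - z) $ i)"
          using that bj[of i] by (auto simp: u_def \<delta> abs_mult intro: mult_left_le_one_le)
      qed
      then show ?thesis using z by (simp add: dist_norm)
    qed
    have "\<exists>t. 0 < t \<and> t < 1 \<and> f (u + 1 *\<^sub>R \<delta>) - f (u + 0 *\<^sub>R \<delta>) = (1 - 0) * (g (u + t *\<^sub>R \<delta>) \<bullet> \<delta>)"
    proof (rule MVT2)
      fix t :: real
      have "((\<lambda>t. u + t *\<^sub>R \<delta>) has_derivative (\<lambda>h. h *\<^sub>R \<delta>)) (at t)"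
        by (auto intro!: derivative_eq_intros)
      from has_derivative_compose[OF this der]
      show "((\<lambda>t. f (u + t *\<^sub>R \<delta>)) has_real_derivative g (u + t *\<^sub>R \<delta>) \<bullet> \<delta>) (at t)"
        by (simp add: has_field_derivative_def mult.commute[of _ "g _ \<bullet> _"] fun_eq_iff)
    qed simp
    then obtain t where t: "0 < t" "t < 1" "f z - f u = g (u + t *\<^sub>R \<delta>) \<bullet> \<delta>"
      by (auto simp: \<delta>_def)
    have "- (c * (\<Sum>j\<in>-G. \<bar>z $ j\<bar>)) = (\<Sum>j\<in>-G. - c * \<bar>z $ j\<bar>)"
      by (simp add: sum_distrib_left sum_negf)
    also have "\<dots> \<le> (\<Sum>j\<in>-G. g (u + t *\<^sub>R \<delta>) $ j * z $ j)"
    proof (rule sum_mono)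
      fix j assume "j \<in> - G"
      then have "\<bar>g (u + t *\<^sub>R \<delta>) $ j\<bar> \<le> c"
        using e1(2)[of "u + t *\<^sub>R \<delta>" j] near[of t] t by (auto simp: dist_commute e0_def intro: less_imp_le)
      then have "\<bar>g (u + t *\<^sub>R \<delta>) $ j * z $ j\<bar> \<le> c * \<bar>z $ j\<bar>"
        by (auto simp: abs_mult intro: mult_right_mono)
      then show "- c * \<bar>z $ j\<bar> \<le> g (u + t *\<^sub>R \<delta>) $ j * z $ j" by simp
    qed
    also have "\<dots> = g (u + t *\<^sub>R \<delta>) \<bullet> \<delta>"
      by (auto simp: inner_vec_def \<delta> intro!: sum.mono_neutral_cong_left)
    finally have loss: "f u - c * (\<Sum>j\<in>-G. \<bar>z $ j\<bar>) \<le> f z" using t by simp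
    have "penalty p z = (\<Sum>j\<in>G. p \<bar>z $ j\<bar>) + (\<Sum>j\<in>-G. p \<bar>z $ j\<bar>)"
      unfolding penalty_def
      by (subst sum.union_disjoint[symmetric]) (auto intro!: sum.cong)
    moreover have "penalty p u = (\<Sum>j\<in>G. p \<bar>z $ j\<bar>)"
      unfolding penalty_def by (auto simp: u_def intro!: sum.mono_neutral_cong_right)
    moreover have "c * (\<Sum>j\<in>-G. \<bar>z $ j\<bar>) \<le> (\<Sum>j\<in>-G. p \<bar>z $ j\<bar>)"
      unfolding sum_distrib_left
    proof (rule sum_mono)
      fix j assume j: "j \<in> - G"
      have "\<bar>z $ j\<bar> = \<bar>(b - z) $ j\<bar>" using bj[of j] j by simp
      also have "\<dots> \<le> norm (b - z)" by (rule component_le_norm_cart)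
      also have "\<dots> < e2" using z by (simp add: dist_norm e0_def)
      finally show "c * \<bar>z $ j\<bar> \<le> p \<bar>z $ j\<bar>" using e2(2) by simp
    qed
    ultimately have "f u + penalty p u \<le> f z + penalty p z" using loss by linarith
    moreover have "f b + penalty p b \<le> f u + penalty p u"
      using near[of 0] by (intro restr) (auto simp: support_def u_def e0_def)
    ultimately show ?thesis by linarith
  qed
  moreover have "e0 > 0" using e e1 e2 by (simp add: e0_def)
  ultimately show ?thesis unfolding local_minimizer_def by blast
qed

end

section \<open>Quadratic forms on a coordinate subspace\<close>

lemma support_add: "support x \<subseteq> G \<Longrightarrow> support z \<subseteq> G \<Longrightarrow> support (x + z) \<subseteq> G"
  and support_diff: "support x \<subseteq> G \<Longrightarrow> support z \<subseteq> G \<Longrightarrow> support (x - z) \<subseteq> G"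
  and support_scaleR: "support x \<subseteq> G \<Longrightarrow> support (c *\<^sub>R x) \<subseteq> G"
  by (fastforce simp: support_def)+

lemma closed_support_subset: "closed {x :: real ^ 'd. support x \<subseteq> G}"
proof -
  have "{x :: real ^ 'd. support x \<subseteq> G} = (\<Inter>j\<in>-G. {x. x $ j = 0})"
    by (auto simp: support_def)
  moreover have "closed {x :: real ^ 'd. x $ j = 0}" for j
    by (intro closed_Collect_eq continuous_intros)
  ultimately show ?thesis by auto
qed

lemma form_sum: "x \<bullet> (A *v z) = (\<Sum>j\<in>UNIV. \<Sum>k\<in>UNIV. x $ j * A $ j $ k * z $ k)"
  for A :: "real ^ 'd ^ 'd"
  by (simp add: inner_vec_def matrix_vector_mult_def sum_distrib_left mult.assoc)

lemma form_commute: "transpose A = A \<Longrightarrow> x \<bullet> (A *v z) = z \<bullet> (A *v x)" for A :: "real ^ 'd ^ 'd"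
  by (metis dot_lmul_matrix inner_commute transpose_matrix_vector)

lemma form_diff:
  "transpose A = A \<Longrightarrow> x \<bullet> (A *v x) - z \<bullet> (A *v z) = (x - z) \<bullet> (A *v (x + z))" for A :: "real ^ 'd ^ 'd"
  using form_commute[of A x z] by (simp add: inner_diff_left inner_add_right matrix_vector_right_distrib)

lemma form_submatrix:
  fixes A :: "real ^ 'd ^ 'd"
  assumes "support x \<subseteq> G" "support z \<subseteq> G"
  shows "x \<bullet> (submatrix G G A *v z) = x \<bullet> (A *v z)"
  using assms unfolding form_sum by (intro sum.cong refl) (auto simp: submatrix_def support_def)

lemma abs_entry_le_max: "\<bar>B $ j $ k\<bar> \<le> max_abs_entry B" for B :: "real ^ 'c ^ 'r"
  unfolding max_abs_entry_def
proof (rule Max_ge)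
  have "{\<bar>B $ x $ y\<bar> | x y. True} = (\<lambda>(x, y). \<bar>B $ x $ y\<bar>) ` UNIV" by auto
  then show "finite {\<bar>B $ x $ y\<bar> | x y. True}" by simp
qed blast

lemma norm_l1_le:
  fixes x :: "real ^ 'd"
  assumes "support x \<subseteq> G"
  shows "(\<Sum>j\<in>UNIV. \<bar>x $ j\<bar>) \<le> sqrt (real (card G)) * norm x"
proof -
  have "(\<Sum>j\<in>UNIV. \<bar>x $ j\<bar>) = (\<Sum>j\<in>G. \<bar>x $ j\<bar> * \<bar>1\<bar>)"
    using assms by (auto simp: support_def intro!: sum.mono_neutral_cong_right)
  also have "\<dots> \<le> L2_set (\<lambda>j. x $ j) G * L2_set (\<lambda>_. 1) G" by (rule L2_set_mult_ineq)
  also have "\<dots> \<le> norm x * sqrt (real (card G))"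
    unfolding norm_vec_def L2_set_def
    by (intro mult_mono) (auto intro!: real_sqrt_le_mono sum_mono2 sum_nonneg)
  finally show ?thesis by (simp add: mult.commute)
qed

text \<open>Polarization, applied to \<open>u\<close> and \<open>v\<close> scaled to equal norms.\<close>

lemma form_le_of_quadratic_le:
  fixes A :: "real ^ 'd ^ 'd"
  assumes sym: "transpose A = A"
    and quad: "\<And>x. support x \<subseteq> G \<Longrightarrow> \<bar>x \<bullet> (A *v x)\<bar> \<le> \<tau> * (norm x)\<^sup>2"
    and u: "support u \<subseteq> G" and v: "support v \<subseteq> G"
  shows "\<bar>u \<bullet> (A *v v)\<bar> \<le> \<tau> * norm u * norm v"
proof (cases "u = 0 \<or> v = 0")
  case False
  define a where "a = (1 / norm u) *\<^sub>R u"
  define b where "b = (1 / norm v) *\<^sub>R v"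
  have ab: "norm a = 1" "norm b = 1" "support a \<subseteq> G" "support b \<subseteq> G"
    using False u v by (auto simp: a_def b_def intro!: support_scaleR)
  have "4 * (a \<bullet> (A *v b)) = (a + b) \<bullet> (A *v (a + b)) - (a - b) \<bullet> (A *v (a - b))"
    using form_commute[OF sym, of a b]
    by (simp add: inner_diff_left inner_diff_right inner_add_left inner_add_right
        matrix_vector_right_distrib matrix_vector_mult_diff_distrib)
  then have "4 * \<bar>a \<bullet> (A *v b)\<bar> \<le> \<bar>(a + b) \<bullet> (A *v (a + b))\<bar> + \<bar>(a - b) \<bullet> (A *v (a - b))\<bar>"
    by linarith
  also have "\<dots> \<le> \<tau> * (norm (a + b))\<^sup>2 + \<tau> * (norm (a - b))\<^sup>2"
    using ab by (intro add_mono quad support_add support_diff)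
  also have "\<dots> = \<tau> * ((norm (a + b))\<^sup>2 + (norm (a - b))\<^sup>2)" by (simp add: distrib_left)
  also have "(norm (a + b))\<^sup>2 + (norm (a - b))\<^sup>2 = 2 * (norm a)\<^sup>2 + 2 * (norm b)\<^sup>2"
    by (simp add: power2_norm_eq_inner inner_diff_left inner_diff_right inner_add_left inner_add_right)
  finally have "\<bar>a \<bullet> (A *v b)\<bar> \<le> \<tau>" using ab by simp
  moreover have "u \<bullet> (A *v v) = norm u * norm v * (a \<bullet> (A *v b))"
    using False by (simp add: a_def b_def matrix_vector_mult_scaleR)
  ultimately show ?thesis
    using mult_left_mono[of "\<bar>a \<bullet> (A *v b)\<bar>" \<tau> "norm u * norm v"] by (simp add: abs_mult mult_ac)
qed auto

section \<open>The objective as a function of the noise matrix\<close>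

text \<open>The smooth part of the objective, up to terms constant in \<open>\<beta>\<close>, with the matrix \<open>A\<close> in place of the
  errors. All that the minimizer can depend on is thus a point of a Euclidean space, and its
  measurability follows from continuity there.\<close>

definition contrast_loss ::
    "nat \<Rightarrow> (nat \<Rightarrow> real ^ 'd ^ 'd) \<Rightarrow> real ^ 'd \<Rightarrow> real ^ 'd ^ 'd \<Rightarrow> real ^ 'd \<Rightarrow> real" where
  "contrast_loss n Z \<beta>s A \<beta> =
     1 / (4 * real n) * (\<Sum>i=1..n. (\<beta> \<bullet> (Z i *v \<beta>) - \<beta>s \<bullet> (Z i *v \<beta>s))\<^sup>2) - 1 / 2 * (\<beta> \<bullet> (A *v \<beta>))"

definition contrast ::
    "nat \<Rightarrow> (nat \<Rightarrow> real ^ 'd ^ 'd) \<Rightarrow> real ^ 'd \<Rightarrow> (real \<Rightarrow> real) \<Rightarrow> real ^ 'd ^ 'd \<Rightarrow> real ^ 'd \<Rightarrow> real" where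
  "contrast n Z \<beta>s p A \<beta> = contrast_loss n Z \<beta>s A \<beta> + penalty p \<beta>"

definition contrast_grad ::
    "nat \<Rightarrow> (nat \<Rightarrow> real ^ 'd ^ 'd) \<Rightarrow> real ^ 'd \<Rightarrow> real ^ 'd ^ 'd \<Rightarrow> real ^ 'd \<Rightarrow> real ^ 'd" where
  "contrast_grad n Z \<beta>s A \<beta> =
     (1 / real n) *\<^sub>R (\<Sum>i=1..n. (\<beta> \<bullet> (Z i *v \<beta>) - \<beta>s \<bullet> (Z i *v \<beta>s)) *\<^sub>R (Z i *v \<beta>)) - A *v \<beta>"

definition noise_matrix :: "nat \<Rightarrow> (nat \<Rightarrow> real ^ 'd ^ 'd) \<Rightarrow> (nat \<Rightarrow> real) \<Rightarrow> real ^ 'd ^ 'd" where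
  "noise_matrix n Z e = (1 / real n) *\<^sub>R (\<Sum>i=1..n. e i *\<^sub>R Z i)"

lemma noise_matrix_form:
  "x \<bullet> (noise_matrix n Z e *v z) = (\<Sum>i=1..n. (x \<bullet> (Z i *v z)) / real n * e i)"
  for Z :: "nat \<Rightarrow> real ^ 'd ^ 'd"
proof -
  have "(\<Sum>i\<in>I. e i *\<^sub>R Z i) *v z = (\<Sum>i\<in>I. e i *\<^sub>R (Z i *v z))" if "finite I" for I
    using that
    by (induction I rule: finite_induct)
       (auto simp: matrix_vector_mult_add_rdistrib scaleR_matrix_vector_assoc)
  then show ?thesis
    by (simp add: noise_matrix_def scaleR_matrix_vector_assoc[symmetric] inner_sum_right sum_distrib_left mult_ac)
qed

lemma noise_matrix_entry: "noise_matrix n Z e $ j $ k = (\<Sum>i=1..n. Z i $ j $ k / real n * e i)"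
  by (simp add: noise_matrix_def sum_distrib_left mult_ac)

lemma transpose_noise_matrix:
  assumes "\<And>i. i \<in> {1..n} \<Longrightarrow> transpose (Z i) = Z i"
  shows "transpose (noise_matrix n Z e) = noise_matrix n Z e"
proof -
  have "Z i $ j $ k = Z i $ k $ j" if "i \<in> {1..n}" for i j k
  proof -
    have "Z i $ j $ k = transpose (Z i) $ j $ k" using assms[OF that] by simp
    then show ?thesis by (simp add: transpose_def)
  qed
  then show ?thesis
    by (auto simp: vec_eq_iff transpose_def noise_matrix_entry intro!: sum.cong)
qed

lemma objective_eq_contrast:
  assumes y: "\<And>i. i \<in> {1..n} \<Longrightarrow> y i = \<beta>s \<bullet> (Z i *v \<beta>s) + e i"
  shows "objective n Z y p \<beta> = contrast n Z \<beta>s p (noise_matrix n Z e) \<beta> +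
    (1 / (4 * real n) * (\<Sum>i=1..n. (e i)\<^sup>2) + 1 / 2 * (\<beta>s \<bullet> (noise_matrix n Z e *v \<beta>s)))"
proof -
  define q where "q i x = x \<bullet> (Z i *v x)" for i x
  have "(\<Sum>i=1..n. (q i \<beta> - y i)\<^sup>2) = (\<Sum>i=1..n. (q i \<beta> - q i \<beta>s)\<^sup>2 - 2 * q i \<beta> * e i + 2 * q i \<beta>s * e i + (e i)\<^sup>2)"
    by (intro sum.cong refl) (simp add: y q_def power2_eq_square algebra_simps)
  also have "\<dots> = (\<Sum>i=1..n. (q i \<beta> - q i \<beta>s)\<^sup>2) - 2 * (\<Sum>i=1..n. q i \<beta> * e i) + 2 * (\<Sum>i=1..n. q i \<beta>s * e i) + (\<Sum>i=1..n. (e i)\<^sup>2)"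
    by (simp add: sum.distrib sum_subtractf sum_distrib_left mult.assoc)
  finally show ?thesis
    unfolding objective_def contrast_def contrast_loss_def noise_matrix_form
    unfolding q_def[symmetric]
    by (simp add: add_divide_distrib diff_divide_distrib flip: sum_divide_distrib)
qed

lemma contrast_loss_has_derivative:
  assumes sym: "\<And>i. i \<in> {1..n} \<Longrightarrow> transpose (Z i) = Z i" and symA: "transpose A = A"
  shows "(contrast_loss n Z \<beta>s A has_derivative (\<lambda>h. contrast_grad n Z \<beta>s A x \<bullet> h)) (at x)"
proof -
  have q: "((\<lambda>x. x \<bullet> (B *v x)) has_derivative (\<lambda>h. 2 * ((B *v x) \<bullet> h))) (at x)"
    if "transpose B = B" for B :: "real ^ 'a ^ 'a"
  proof -
    have "((\<lambda>x. x \<bullet> (B *v x)) has_derivative (\<lambda>h. x \<bullet> (B *v h) + h \<bullet> (B *v x))) (at x)"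
      by (rule has_derivative_inner[OF has_derivative_ident
            bounded_linear.has_derivative[OF matrix_vector_mul_bounded_linear has_derivative_ident]])
    moreover have "x \<bullet> (B *v h) + h \<bullet> (B *v x) = 2 * ((B *v x) \<bullet> h)" for h
      using form_commute[OF that, of x h] by (simp add: inner_commute)
    ultimately show ?thesis by simp
  qed
  have sq: "((\<lambda>x. (x \<bullet> (B *v x) - c)\<^sup>2) has_derivative (\<lambda>h. 2 * (2 * ((B *v x) \<bullet> h)) * (x \<bullet> (B *v x) - c))) (at x)"
    if "transpose B = B" for B :: "real ^ 'a ^ 'a" and c
    using has_derivative_power[OF has_derivative_diff[OF q[OF that] has_derivative_const[of c]], where n = 2]
    by simp
  have "((\<lambda>x. 1 / (4 * real n) * (\<Sum>i=1..n. (x \<bullet> (Z i *v x) - \<beta>s \<bullet> (Z i *v \<beta>s))\<^sup>2) - 1 / 2 * (x \<bullet> (A *v x)))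
     has_derivative (\<lambda>h. 1 / (4 * real n) * (\<Sum>i=1..n. 2 * (2 * ((Z i *v x) \<bullet> h)) * (x \<bullet> (Z i *v x) - \<beta>s \<bullet> (Z i *v \<beta>s)))
        - 1 / 2 * (2 * ((A *v x) \<bullet> h)))) (at x)"
    by (intro has_derivative_diff has_derivative_mult_right has_derivative_sum sq q sym symA)
  moreover have "1 / (4 * real n) * (\<Sum>i=1..n. 2 * (2 * ((Z i *v x) \<bullet> h)) * (x \<bullet> (Z i *v x) - \<beta>s \<bullet> (Z i *v \<beta>s)))
        - 1 / 2 * (2 * ((A *v x) \<bullet> h)) = contrast_grad n Z \<beta>s A x \<bullet> h" for h
    by (simp add: contrast_grad_def inner_diff_left inner_sum_left sum_distrib_left mult_ac)
  ultimately show ?thesis by (simp add: contrast_loss_def[abs_def])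
qed

lemma continuous_on_contrast_grad: "continuous_on UNIV (contrast_grad n Z \<beta>s A)"
  unfolding contrast_grad_def[abs_def]
  by (intro continuous_intros linear_continuous_on matrix_vector_mul_bounded_linear)

lemma continuous_on_contrast:
  assumes "weakly_convex_concave p \<mu> lam rho"
  shows "continuous_on UNIV (\<lambda>(A, x). contrast n Z \<beta>s p A x)"
proof -
  have "continuous_on UNIV (\<lambda>z :: (real ^ 'd ^ 'd) \<times> (real ^ 'd). penalty p (snd z))"
    by (rule continuous_on_compose2[OF continuous_on_penalty[OF assms]]) (auto intro!: continuous_intros)
  then show ?thesis
    unfolding contrast_def contrast_loss_def form_sum case_prod_beta by (intro continuous_intros)
qed

text \<open>The gradient of the loss vanishes at the origin, so the penalty makes the origin a local
  minimizer whatever the errors are.\<close>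

lemma local_minimizer_zero:
  fixes Z :: "nat \<Rightarrow> real ^ 'd ^ 'd"
  assumes pen: "weakly_convex_concave p \<mu> lam rho" and lr: "0 < lam * rho"
    and sym: "\<And>i. i \<in> {1..n} \<Longrightarrow> transpose (Z i) = Z i" and symA: "transpose A = A"
  shows "local_minimizer (contrast n Z \<beta>s p A) 0"
  unfolding contrast_def[abs_def]
proof (rule local_minimizer_of_restricted[OF pen contrast_loss_has_derivative[OF sym symA]
      continuous_on_contrast_grad, where G = "{}" and e = 1])
  fix z :: "real ^ 'd" assume "support z \<subseteq> {}"
  then have "z = 0" by (auto simp: support_def vec_eq_iff)
  then show "contrast_loss n Z \<beta>s A 0 + penalty p (0 :: real ^ 'd) \<le> contrast_loss n Z \<beta>s A z + penalty p z" by simp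
qed (use lr in \<open>auto simp: support_def contrast_grad_def\<close>)

section \<open>The restricted problem under small noise\<close>

context
  fixes n :: nat and Z :: "nat \<Rightarrow> real ^ 'd ^ 'd" and \<beta>s :: "real ^ 'd" and \<Gamma> :: "'d set"
    and p :: "real \<Rightarrow> real" and \<mu> lam rho c3 c4 c5 \<tau> t :: real and A :: "real ^ 'd ^ 'd"
  assumes n: "0 < n"
    and sym: "\<And>i. i \<in> {1..n} \<Longrightarrow> transpose (Z i) = Z i"
    and \<Gamma>: "\<Gamma> = support \<beta>s"
    and pen: "weakly_convex_concave p \<mu> lam rho"
    and iso: "restricted_isometry n Z \<Gamma> c3 c4"
    and cross: "low_cross_correlation n Z \<Gamma> c5"
    and symA: "transpose A = A"
    and quadA: "\<And>x. support x \<subseteq> \<Gamma> \<Longrightarrow> \<bar>x \<bullet> (A *v x)\<bar> \<le> \<tau> * (norm x)\<^sup>2"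
    and entryA: "\<And>j k. \<bar>A $ j $ k\<bar> \<le> t"
begin

lemma isometry:
  assumes "support u \<subseteq> \<Gamma>" "support v \<subseteq> \<Gamma>"
  shows "c3 * (norm u)\<^sup>2 * (norm v)\<^sup>2 \<le> 1 / real n * (\<Sum>i=1..n. (u \<bullet> (Z i *v v))\<^sup>2)"
    and "1 / real n * (\<Sum>i=1..n. (u \<bullet> (Z i *v v))\<^sup>2) \<le> c4 * (norm u)\<^sup>2 * (norm v)\<^sup>2"
  using iso assms unfolding restricted_isometry_def by (simp_all add: form_submatrix)

lemma form_diff_square_sum:
  "(\<Sum>i=1..n. (x \<bullet> (Z i *v x) - z \<bullet> (Z i *v z))\<^sup>2) = (\<Sum>i=1..n. ((x - z) \<bullet> (Z i *v (x + z)))\<^sup>2)"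
  by (intro sum.cong refl) (simp add: form_diff sym)

text \<open>Within the support, the noise-free loss grows quadratically with the distance to \<open>\<beta>s\<close>, whereas noise
  and penalty can lower the objective at most linearly.\<close>

lemma contrast_excess:
  assumes x: "support x \<subseteq> \<Gamma>"
  shows "norm (x - \<beta>s) * (c3 / 4 * norm (x - \<beta>s) * (norm (x + \<beta>s))\<^sup>2 - \<tau> / 2 * norm (x + \<beta>s)
       - lam * rho * sqrt (real (card \<Gamma>))) \<le> contrast n Z \<beta>s p A x - contrast n Z \<beta>s p A \<beta>s"
proof -
  have supp: "support (x - \<beta>s) \<subseteq> \<Gamma>" "support (x + \<beta>s) \<subseteq> \<Gamma>"
    using x \<Gamma> by (simp_all add: support_diff support_add)
  have "c3 * (norm (x - \<beta>s))\<^sup>2 * (norm (x + \<beta>s))\<^sup>2 / 4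
      \<le> 1 / (4 * real n) * (\<Sum>i=1..n. (x \<bullet> (Z i *v x) - \<beta>s \<bullet> (Z i *v \<beta>s))\<^sup>2)"
    unfolding form_diff_square_sum using isometry(1)[OF supp] by simp
  moreover have "x \<bullet> (A *v x) - \<beta>s \<bullet> (A *v \<beta>s) \<le> \<tau> * norm (x - \<beta>s) * norm (x + \<beta>s)"
    using form_le_of_quadratic_le[OF symA quadA supp] form_diff[OF symA, of x \<beta>s] by simp
  moreover have "penalty p \<beta>s - penalty p x \<le> lam * rho * (sqrt (real (card \<Gamma>)) * norm (x - \<beta>s))"
  proof -
    have "penalty p \<beta>s - penalty p x \<le> lam * rho * (\<Sum>j\<in>UNIV. \<bar>(x - \<beta>s) $ j\<bar>)"
      using penalty_vec_increment_le[OF pen, of \<beta>s x] by (simp add: abs_minus_commute)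
    also have "\<dots> \<le> lam * rho * (sqrt (real (card \<Gamma>)) * norm (x - \<beta>s))"
      by (intro mult_left_mono norm_l1_le supp lam_rho_nonneg[OF pen])
    finally show ?thesis .
  qed
  ultimately show ?thesis
    by (simp add: contrast_def contrast_loss_def power2_eq_square algebra_simps)
qed

text \<open>If a residual is \<open>R \<plusminus> 2 * b + c\<close> at \<open>a \<plusminus> e\<close> and \<open>R\<close> at \<open>a\<close>, then the second difference of its square is
  \<open>8 * b\<^sup>2 + 4 * R * c + 2 * c\<^sup>2\<close>. The restricted isometry bounds the sum of the first terms from below
  and, with Cauchy-Schwarz, the size of the sum of the second ones from above. The losses \<open>\<tau>\<close> and \<open>\<mu>\<close>
  are due to the noise and to the concavity of the penalty.\<close>

lemma contrast_midpoint:
  assumes a: "support a \<subseteq> \<Gamma>" and e: "support e \<subseteq> \<Gamma>"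
  shows "(2 * c3 * (norm a)\<^sup>2 - c4 * norm (a - \<beta>s) * norm (a + \<beta>s) - \<tau> - \<mu>) * (norm e)\<^sup>2
    \<le> contrast n Z \<beta>s p A (a + e) + contrast n Z \<beta>s p A (a - e) - 2 * contrast n Z \<beta>s p A a"
proof -
  define R where "R i = a \<bullet> (Z i *v a) - \<beta>s \<bullet> (Z i *v \<beta>s)" for i
  define b where "b i = a \<bullet> (Z i *v e)" for i
  define c where "c i = e \<bullet> (Z i *v e)" for i
  have supp: "support (a - \<beta>s) \<subseteq> \<Gamma>" "support (a + \<beta>s) \<subseteq> \<Gamma>"
    using a \<Gamma> by (simp_all add: support_diff support_add)
  have c4: "0 \<le> c4" using iso by (auto simp: restricted_isometry_def)
  have expand: "(a + e) \<bullet> (B *v (a + e)) = a \<bullet> (B *v a) + 2 * (a \<bullet> (B *v e)) + e \<bullet> (B *v e)"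
    "(a - e) \<bullet> (B *v (a - e)) = a \<bullet> (B *v a) - 2 * (a \<bullet> (B *v e)) + e \<bullet> (B *v e)"
    if "transpose B = B" for B :: "real ^ 'd ^ 'd"
    using form_commute[OF that, of a e]
    by (simp_all add: inner_diff_left inner_diff_right inner_add_left inner_add_right
        matrix_vector_right_distrib matrix_vector_mult_diff_distrib)
  have square: "(Q + 2 * B + C - T)\<^sup>2 + (Q - 2 * B + C - T)\<^sup>2 - 2 * (Q - T)\<^sup>2 = 8 * B\<^sup>2 + 4 * ((Q - T) * C) + 2 * C\<^sup>2"
    for Q B C T :: real by (simp add: power2_eq_square algebra_simps)
  have sq: "(\<Sum>i=1..n. ((a + e) \<bullet> (Z i *v (a + e)) - \<beta>s \<bullet> (Z i *v \<beta>s))\<^sup>2)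
      + (\<Sum>i=1..n. ((a - e) \<bullet> (Z i *v (a - e)) - \<beta>s \<bullet> (Z i *v \<beta>s))\<^sup>2) - 2 * (\<Sum>i=1..n. (R i)\<^sup>2)
      = 8 * (\<Sum>i=1..n. (b i)\<^sup>2) + 4 * (\<Sum>i=1..n. R i * c i) + 2 * (\<Sum>i=1..n. (c i)\<^sup>2)"
    unfolding sum_distrib_left sum.distrib[symmetric] sum_subtractf[symmetric]
    by (intro sum.cong refl)
       (simp only: expand[OF sym] R_def b_def c_def square)
  have "\<bar>1 / real n * (\<Sum>i=1..n. R i * c i)\<bar> \<le> c4 * norm (a - \<beta>s) * norm (a + \<beta>s) * (norm e)\<^sup>2"
  proof (rule power2_le_imp_le)
    have "(1 / real n * (\<Sum>i=1..n. R i * c i))\<^sup>2 \<le> (1 / real n)\<^sup>2 * ((\<Sum>i=1..n. (R i)\<^sup>2) * (\<Sum>i=1..n. (c i)\<^sup>2))"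
      unfolding power_mult_distrib by (intro mult_left_mono Cauchy_Schwarz_ineq_sum) auto
    also have "\<dots> = (1 / real n * (\<Sum>i=1..n. (R i)\<^sup>2)) * (1 / real n * (\<Sum>i=1..n. (c i)\<^sup>2))"
      by (simp add: power2_eq_square)
    also have "\<dots> \<le> (c4 * (norm (a - \<beta>s))\<^sup>2 * (norm (a + \<beta>s))\<^sup>2) * (c4 * (norm e)\<^sup>2 * (norm e)\<^sup>2)"
      using isometry(2)[OF supp, folded form_diff_square_sum, folded R_def] isometry(2)[OF e e, folded c_def]
      by (rule mult_mono) (use c4 in \<open>auto simp: sum_nonneg\<close>)
    also have "\<dots> = (c4 * norm (a - \<beta>s) * norm (a + \<beta>s) * (norm e)\<^sup>2)\<^sup>2"
      by (simp add: power2_eq_square mult_ac)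
    finally show "\<bar>1 / real n * (\<Sum>i=1..n. R i * c i)\<bar>\<^sup>2 \<le> (c4 * norm (a - \<beta>s) * norm (a + \<beta>s) * (norm e)\<^sup>2)\<^sup>2"
      by (simp only: power2_abs)
  qed (use c4 in auto)
  moreover have "c3 * (norm a)\<^sup>2 * (norm e)\<^sup>2 \<le> 1 / real n * (\<Sum>i=1..n. (b i)\<^sup>2)"
    using isometry(1)[OF a e] by (simp add: b_def)
  moreover have "0 \<le> 1 / real n * (\<Sum>i=1..n. (c i)\<^sup>2)" by (simp add: sum_nonneg)
  moreover have "\<bar>e \<bullet> (A *v e)\<bar> \<le> \<tau> * (norm e)\<^sup>2" by (rule quadA[OF e])
  moreover have "2 * penalty p a \<le> penalty p (a + e) + penalty p (a - e) + \<mu> * (norm e)\<^sup>2"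
    by (rule penalty_midpoint[OF pen])
  moreover have "contrast n Z \<beta>s p A (a + e) + contrast n Z \<beta>s p A (a - e) - 2 * contrast n Z \<beta>s p A a
     = 2 * (1 / real n * (\<Sum>i=1..n. (b i)\<^sup>2)) + 1 / real n * (\<Sum>i=1..n. R i * c i) + 1 / 2 * (1 / real n * (\<Sum>i=1..n. (c i)\<^sup>2))
       - e \<bullet> (A *v e) + (penalty p (a + e) + penalty p (a - e) - 2 * penalty p a)"
  proof -
    have "1 / (4 * real n) * (X + Y - 2 * W) = 1 / (4 * real n) * X + 1 / (4 * real n) * Y - 2 * (1 / (4 * real n) * W)"
      for X Y W by (simp add: algebra_simps add_divide_distrib diff_divide_distrib)
    note scale = this
    have combine: "X - 1 / 2 * (P + 2 * Q + E) + (Y - 1 / 2 * (P - 2 * Q + E)) - 2 * (U - 1 / 2 * P) = W - E"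
      if "W = X + Y - 2 * U" for X Y U W P Q E :: real using that by (simp add: field_simps)
    from scale[of "\<Sum>i=1..n. ((a + e) \<bullet> (Z i *v (a + e)) - \<beta>s \<bullet> (Z i *v \<beta>s))\<^sup>2"
        "\<Sum>i=1..n. ((a - e) \<bullet> (Z i *v (a - e)) - \<beta>s \<bullet> (Z i *v \<beta>s))\<^sup>2" "\<Sum>i=1..n. (R i)\<^sup>2", unfolded sq]
    have "contrast_loss n Z \<beta>s A (a + e) + contrast_loss n Z \<beta>s A (a - e) - 2 * contrast_loss n Z \<beta>s A a
      = 1 / (4 * real n) * (8 * (\<Sum>i=1..n. (b i)\<^sup>2) + 4 * (\<Sum>i=1..n. R i * c i) + 2 * (\<Sum>i=1..n. (c i)\<^sup>2)) - e \<bullet> (A *v e)"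
      unfolding contrast_loss_def R_def[symmetric] expand[OF symA] by (rule combine)
    also have "1 / (4 * real n) * (8 * (\<Sum>i=1..n. (b i)\<^sup>2) + 4 * (\<Sum>i=1..n. R i * c i) + 2 * (\<Sum>i=1..n. (c i)\<^sup>2))
      = 2 * (1 / real n * (\<Sum>i=1..n. (b i)\<^sup>2)) + 1 / real n * (\<Sum>i=1..n. R i * c i) + 1 / 2 * (1 / real n * (\<Sum>i=1..n. (c i)\<^sup>2))"
      using n by (simp add: field_simps)
    finally show ?thesis by (simp add: contrast_def)
  qed
  ultimately show ?thesis by (simp only: abs_le_iff left_diff_distrib mult.assoc) linarith
qed

lemma cross_entry_le:
  assumes "k \<in> \<Gamma>" "l \<in> \<Gamma>" "m \<in> \<Gamma>" "j \<notin> \<Gamma>"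
  shows "\<bar>\<Sum>i=1..n. Z i $ k $ l * Z i $ j $ m\<bar> \<le> c5 * sqrt (real n)"
proof -
  define B where "B = (\<Sum>i=1..n. kronecker (submatrix \<Gamma> \<Gamma> (Z i)) (submatrix (- \<Gamma>) \<Gamma> (Z i)))"
  have "B $ (k, j) $ (l, m) = (\<Sum>i=1..n. Z i $ k $ l * Z i $ j $ m)"
    using assms by (simp add: B_def kronecker_def submatrix_def)
  moreover have "\<bar>B $ (k, j) $ (l, m)\<bar> \<le> max_abs_entry B" by (rule abs_entry_le_max)
  ultimately show ?thesis using cross by (simp add: low_cross_correlation_def B_def)
qed

text \<open>Written in coordinates, the noise-free part of the gradient is a trilinear form in \<open>x - \<beta>s\<close>,
  \<open>x + \<beta>s\<close> and \<open>x\<close> whose coefficients are entries of the cross-correlation matrix.\<close>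

lemma contrast_grad_off_support:
  assumes x: "support x \<subseteq> \<Gamma>" and j: "j \<notin> \<Gamma>"
  shows "\<bar>contrast_grad n Z \<beta>s A x $ j\<bar>
    \<le> (c5 / sqrt (real n) * (\<Sum>k\<in>UNIV. \<bar>(x - \<beta>s) $ k\<bar>) * (\<Sum>l\<in>UNIV. \<bar>(x + \<beta>s) $ l\<bar>) + t) * (\<Sum>m\<in>UNIV. \<bar>x $ m\<bar>)"
proof -
  define h where "h = x - \<beta>s"
  define w where "w = x + \<beta>s"
  have supp: "support h \<subseteq> \<Gamma>" "support w \<subseteq> \<Gamma>"
    using x \<Gamma> by (simp_all add: h_def w_def support_diff support_add)
  have zero: "h $ k = 0" "w $ k = 0" "x $ k = 0" if "k \<notin> \<Gamma>" for k
    using supp x that by (auto simp: support_def)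
  have "(\<Sum>i=1..n. (x \<bullet> (Z i *v x) - \<beta>s \<bullet> (Z i *v \<beta>s)) * (Z i *v x) $ j)
    = (\<Sum>i=1..n. (\<Sum>k\<in>UNIV. \<Sum>l\<in>UNIV. h $ k * Z i $ k $ l * w $ l) * (\<Sum>m\<in>UNIV. Z i $ j $ m * x $ m))"
  proof (intro sum.cong refl)
    fix i assume "i \<in> {1..n}"
    from form_diff[OF sym[OF this], of x \<beta>s]
    have "x \<bullet> (Z i *v x) - \<beta>s \<bullet> (Z i *v \<beta>s) = (\<Sum>k\<in>UNIV. \<Sum>l\<in>UNIV. h $ k * Z i $ k $ l * w $ l)"
      unfolding h_def[symmetric] w_def[symmetric] form_sum[of h] .
    then show "(x \<bullet> (Z i *v x) - \<beta>s \<bullet> (Z i *v \<beta>s)) * (Z i *v x) $ j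
      = (\<Sum>k\<in>UNIV. \<Sum>l\<in>UNIV. h $ k * Z i $ k $ l * w $ l) * (\<Sum>m\<in>UNIV. Z i $ j $ m * x $ m)"
      by (simp only: matrix_vector_mult_def vec_lambda_beta)
  qed
  also have "\<dots> = (\<Sum>i=1..n. \<Sum>k\<in>UNIV. \<Sum>l\<in>UNIV. \<Sum>m\<in>UNIV. h $ k * w $ l * x $ m * (Z i $ k $ l * Z i $ j $ m))"
    by (simp add: sum_distrib_left sum_distrib_right mult_ac)
  also have "\<dots> = (\<Sum>k\<in>UNIV. \<Sum>l\<in>UNIV. \<Sum>m\<in>UNIV. \<Sum>i=1..n. h $ k * w $ l * x $ m * (Z i $ k $ l * Z i $ j $ m))"
    by (simp only: sum.swap[of _ "{1..n}"])
  also have "\<dots> = (\<Sum>k\<in>UNIV. \<Sum>l\<in>UNIV. \<Sum>m\<in>UNIV. h $ k * w $ l * x $ m * (\<Sum>i=1..n. Z i $ k $ l * Z i $ j $ m))"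
    by (simp only: sum_distrib_left)
  finally have expand: "(\<Sum>i=1..n. (x \<bullet> (Z i *v x) - \<beta>s \<bullet> (Z i *v \<beta>s)) * (Z i *v x) $ j) = \<dots>" .
  have "\<bar>\<Sum>i=1..n. (x \<bullet> (Z i *v x) - \<beta>s \<bullet> (Z i *v \<beta>s)) * (Z i *v x) $ j\<bar>
     \<le> (\<Sum>k\<in>UNIV. \<Sum>l\<in>UNIV. \<Sum>m\<in>UNIV. \<bar>h $ k\<bar> * \<bar>w $ l\<bar> * \<bar>x $ m\<bar> * (c5 * sqrt (real n)))"
    unfolding expand
  proof (intro order_trans[OF sum_abs] sum_mono)
    fix k l m
    show "\<bar>h $ k * w $ l * x $ m * (\<Sum>i=1..n. Z i $ k $ l * Z i $ j $ m)\<bar> \<le> \<bar>h $ k\<bar> * \<bar>w $ l\<bar> * \<bar>x $ m\<bar> * (c5 * sqrt (real n))"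
    proof (cases "k \<in> \<Gamma> \<and> l \<in> \<Gamma> \<and> m \<in> \<Gamma>")
      case True
      then show ?thesis
        unfolding abs_mult[of _ "sum _ _"] using cross_entry_le[of k l m j] j
        by (intro mult_mono) (auto simp: abs_mult)
    qed (use zero in auto)
  qed
  also have "\<dots> = c5 * sqrt (real n) * (\<Sum>k\<in>UNIV. \<bar>h $ k\<bar>) * (\<Sum>l\<in>UNIV. \<bar>w $ l\<bar>) * (\<Sum>m\<in>UNIV. \<bar>x $ m\<bar>)"
    by (simp add: sum_distrib_left sum_distrib_right mult_ac)
  finally have "1 / real n * \<bar>\<Sum>i=1..n. (x \<bullet> (Z i *v x) - \<beta>s \<bullet> (Z i *v \<beta>s)) * (Z i *v x) $ j\<bar>
     \<le> 1 / real n * (c5 * sqrt (real n) * (\<Sum>k\<in>UNIV. \<bar>h $ k\<bar>) * (\<Sum>l\<in>UNIV. \<bar>w $ l\<bar>) * (\<Sum>m\<in>UNIV. \<bar>x $ m\<bar>))"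
    by (rule mult_left_mono) simp
  also have "\<dots> = c5 / sqrt (real n) * (\<Sum>k\<in>UNIV. \<bar>h $ k\<bar>) * (\<Sum>l\<in>UNIV. \<bar>w $ l\<bar>) * (\<Sum>m\<in>UNIV. \<bar>x $ m\<bar>)"
    using n by (simp add: field_simps real_sqrt_mult_self flip: real_sqrt_mult)
  finally have 1: "\<bar>1 / real n * (\<Sum>i=1..n. (x \<bullet> (Z i *v x) - \<beta>s \<bullet> (Z i *v \<beta>s)) * (Z i *v x) $ j)\<bar> \<le> \<dots>"
    by (simp add: abs_mult)
  have 2: "\<bar>(A *v x) $ j\<bar> \<le> t * (\<Sum>m\<in>UNIV. \<bar>x $ m\<bar>)"
    unfolding matrix_vector_mult_def sum_distrib_left
    by (auto simp: abs_mult intro!: order_trans[OF sum_abs] sum_mono mult_right_mono entryA)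
  have grad: "contrast_grad n Z \<beta>s A x $ j
    = 1 / real n * (\<Sum>i=1..n. (x \<bullet> (Z i *v x) - \<beta>s \<bullet> (Z i *v \<beta>s)) * (Z i *v x) $ j) - (A *v x) $ j"
    by (simp add: contrast_grad_def)
  show ?thesis
    unfolding grad distrib_right h_def[symmetric] w_def[symmetric]
    by (rule order_trans[OF abs_triangle_ineq4 add_mono[OF 1 2]])
qed

text \<open>On the ball of radius \<open>r\<close> the objective restricted to \<open>\<Gamma>\<close> is strictly midpoint convex, it
  exceeds its value at the centre on the boundary, and the remaining partial derivatives of the loss
  are smaller than the slope \<open>lam * rho\<close> of the penalty.\<close>

lemma contrast_unique_local_minimizer:
  fixes S B L C0 c1 c2 q r :: real
  defines "S \<equiv> sqrt (real (card \<Gamma>))"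
  assumes S: "0 < S" and lr: "0 < lam * rho" and q: "0 \<le> q" and L: "0 \<le> L"
    and c: "0 < c1" "c1 \<le> c2"
    and truth: "c1 * S \<le> norm \<beta>s" "norm \<beta>s \<le> c2 * S"
    and C0: "10 * q \<le> C0 * c1 * c3" "4 \<le> C0 * c1\<^sup>2 * c3"
    and r: "r = C0 * (L + lam * rho / S)"
    and \<tau>: "\<tau> = 5 * q * (S * L)"
    and sample: "36 * c2\<^sup>2 * c5 * C0 * (real (card \<Gamma>))\<^sup>2 \<le> sqrt (real n)"
    and lam_lower: "S * L \<le> lam * rho" "3 * c2 * real (card \<Gamma>) * t \<le> lam * rho"
    and mu: "\<mu> \<le> c1\<^sup>2 * c3 * real (card \<Gamma>)"
    and radius: "2 * (4 * c3 + 3 * c4) * c2 * r + 10 * q * L \<le> c1\<^sup>2 * c3 * S"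
  defines "K \<equiv> {x. support x \<subseteq> \<Gamma>} \<inter> cball \<beta>s r"
  shows "\<exists>!x. x \<in> K \<and> (\<forall>z\<in>K. contrast n Z \<beta>s p A x \<le> contrast n Z \<beta>s p A z)"
    and "x \<in> K \<Longrightarrow> (\<And>z. z \<in> K \<Longrightarrow> contrast n Z \<beta>s p A x \<le> contrast n Z \<beta>s p A z)
      \<Longrightarrow> local_minimizer (contrast n Z \<beta>s p A) x"
proof -
  have c34: "0 < c3" "c3 \<le> c4" using iso by (auto simp: restricted_isometry_def)
  have c5: "0 < c5" using cross by (simp add: low_cross_correlation_def)
  have t: "0 \<le> t" using entryA[of undefined undefined] by linarith
  have s: "real (card \<Gamma>) = S * S" by (simp add: S_def)
  have C0_pos: "0 < C0"
  proof (rule ccontr)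
    assume "\<not> 0 < C0"
    then have "C0 * c1\<^sup>2 * c3 \<le> 0" using c c34 by (simp add: mult_nonpos_nonneg)
    then show False using C0(2) by linarith
  qed
  have r_pos: "0 < r" unfolding r using C0_pos L lr S by (intro mult_pos_pos add_nonneg_pos) auto
  have c2: "0 < c2" using c by linarith
  \<comment> \<open>The radius condition, \<open>c3 \<le> c4\<close> and \<open>c1 \<le> c2\<close> leave \<open>2 * (4 + 3) = 14\<close> multiples of \<open>r\<close> below \<open>c1 * S\<close>, so the
     ball is small compared with the norm of its centre.\<close>
  have "14 * c3 * c2 * r \<le> 2 * (4 * c3 + 3 * c4) * c2 * r"
    using c34 c2 r_pos by (intro mult_right_mono) auto
  also have "\<dots> \<le> c1\<^sup>2 * c3 * S" using radius q L by (smt (verit) mult_nonneg_nonneg)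
  finally have "c3 * (14 * (c2 * r)) \<le> c3 * (c1 * (c1 * S))" by (simp add: power2_eq_square mult_ac)
  then have "14 * (c2 * r) \<le> c1 * (c1 * S)" using c34 by simp
  also have "\<dots> \<le> c2 * (c1 * S)" using c S by (intro mult_right_mono) auto
  finally have "c2 * (14 * r) \<le> c2 * (c1 * S)" by simp
  then have r_le: "14 * r \<le> c1 * S" using c2 by simp
  have "c1 * S \<le> c2 * S" using c S by simp
  then have r_le2: "14 * r \<le> c2 * S" using r_le by linarith
  have supp_\<beta>s: "support \<beta>s \<subseteq> \<Gamma>" using \<Gamma> by simp
  have plus: "x + \<beta>s = 2 *\<^sub>R \<beta>s + (x - \<beta>s)" for x by (simp add: scaleR_2)
  have norm_plus: "norm (x + \<beta>s) \<le> 29 / 14 * (c2 * S)" "27 / 14 * (c1 * S) \<le> norm (x + \<beta>s)"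
    if "norm (x - \<beta>s) \<le> r" for x
    using that truth r_le r_le2 norm_triangle_ineq[of "2 *\<^sub>R \<beta>s" "x - \<beta>s"]
      norm_diff_ineq[of "2 *\<^sub>R \<beta>s" "x - \<beta>s"] unfolding plus[of x] by simp_all
  have norm_x: "norm x \<le> 15 / 14 * (c2 * S)" "norm \<beta>s - r \<le> norm x" if "norm (x - \<beta>s) \<le> r" for x
    using that truth r_le2 norm_triangle_ineq2[of x \<beta>s] norm_triangle_ineq3[of x \<beta>s] by simp_all

  have boundary: "contrast n Z \<beta>s p A \<beta>s < contrast n Z \<beta>s p A x"
    if x: "support x \<subseteq> \<Gamma>" "norm (x - \<beta>s) = r" for x
  proof -
    define D where "D = norm (x + \<beta>s)"
    have D: "27 / 14 * (c1 * S) \<le> D" using norm_plus(2)[of x] x by (simp add: D_def)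
    have cS: "0 < c1 * S" using c S by simp
    have D0: "0 < D" using D cS by linarith
    \<comment> \<open>The two summands of \<open>r\<close> pay for the noise and for the penalty separately; the
       lower bounds on \<open>C0\<close> are scaled for this.\<close>
    have noise: "\<tau> / 2 * D \<le> c3 / 4 * (C0 * L) * D\<^sup>2"
    proof -
      have "\<tau> / 2 * D = (10 * q) * (S * L * D) / 4" by (simp add: \<tau>)
      also have "\<dots> \<le> (C0 * c1 * c3) * (S * L * D) / 4"
        using C0(1) S L D0 by (intro divide_right_mono mult_right_mono) auto
      also have "\<dots> = (c1 * S) * (c3 / 4 * (C0 * L) * D)" by simp
      also have "\<dots> \<le> D * (c3 / 4 * (C0 * L) * D)"
        using D cS c34 C0_pos L D0 by (intro mult_right_mono) auto
      finally show ?thesis by (simp add: power2_eq_square mult_ac)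
    qed
    have pen_part: "lam * rho * S < c3 / 4 * (C0 * (lam * rho / S)) * D\<^sup>2"
    proof -
      have "lam * rho * S * 4 < lam * rho * S * ((27 / 14)\<^sup>2 * 4)"
        using lr S by (simp add: power2_eq_square)
      also have "\<dots> \<le> lam * rho * S * ((27 / 14)\<^sup>2 * (C0 * c1\<^sup>2 * c3))"
        using C0(2) lr S by (intro mult_left_mono) auto
      also have "\<dots> = c3 * (C0 * (lam * rho / S)) * (27 / 14 * (c1 * S))\<^sup>2"
        using S by (simp add: power2_eq_square)
      also have "\<dots> \<le> c3 * (C0 * (lam * rho / S)) * D\<^sup>2"
        using D cS c34 C0_pos lr S by (intro mult_left_mono power_mono) auto
      finally have "lam * rho * S * 4 < c3 / 4 * (C0 * (lam * rho / S)) * D\<^sup>2 * 4" by simp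
      then show ?thesis by (rule mult_right_less_imp_less) simp
    qed
    have "0 < c3 / 4 * r * D\<^sup>2 - \<tau> / 2 * D - lam * rho * S"
      using noise pen_part by (simp add: r algebra_simps)
    then have "0 < r * (c3 / 4 * r * D\<^sup>2 - \<tau> / 2 * D - lam * rho * S)" using r_pos by simp
    also have "\<dots> \<le> contrast n Z \<beta>s p A x - contrast n Z \<beta>s p A \<beta>s"
      using contrast_excess[OF x(1)] by (simp add: x(2) D_def S_def)
    finally show ?thesis by simp
  qed

  have curvature: "0 < 2 * c3 * (norm a)\<^sup>2 - c4 * norm (a - \<beta>s) * norm (a + \<beta>s) - \<tau> - \<mu>"
    if a: "norm (a - \<beta>s) \<le> r" for a
  proof -
    have "c1 * S - r \<ge> 0" using r_le r_pos by linarith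
    then have "(norm \<beta>s - r)\<^sup>2 \<le> (norm a)\<^sup>2"
      using norm_x(2)[OF a] truth by (intro power_mono) auto
    moreover have "(norm \<beta>s - r)\<^sup>2 \<ge> (norm \<beta>s)\<^sup>2 - 2 * r * norm \<beta>s"
      by (simp add: power2_diff)
    moreover have "(c1 * S)\<^sup>2 \<le> (norm \<beta>s)\<^sup>2" using truth c S by (intro power_mono) auto
    moreover have "2 * r * norm \<beta>s \<le> 2 * r * (c2 * S)" using truth r_pos by (intro mult_left_mono) auto
    ultimately have "(c1 * S)\<^sup>2 - 2 * r * (c2 * S) \<le> (norm a)\<^sup>2" by linarith
    then have 1: "2 * c3 * ((c1 * S)\<^sup>2 - 2 * r * (c2 * S)) \<le> 2 * c3 * (norm a)\<^sup>2"
      using c34 by (intro mult_left_mono) auto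
    have "0 < c2 * S" using c2 S by simp
    then have norm_le: "norm (a + \<beta>s) \<le> 3 * (c2 * S)" using norm_plus(1)[OF a] by linarith
    have 2: "c4 * norm (a - \<beta>s) * norm (a + \<beta>s) \<le> c4 * r * (3 * (c2 * S))"
      using a norm_le c34 r_pos by (intro mult_mono) auto
    \<comment> \<open>The radius condition, scaled by \<open>S\<close>, bounds twice the total loss of curvature.\<close>
    have 3: "S * (2 * (4 * c3 + 3 * c4) * c2 * r + 10 * q * L) \<le> S * (c1\<^sup>2 * c3 * S)"
      using radius S by (intro mult_left_mono) auto
    have 4: "0 < c1\<^sup>2 * c3 * (S * S)" using c c34 S by simp
    have "0 < 2 * c3 * ((c1 * S)\<^sup>2 - 2 * r * (c2 * S)) - c4 * r * (3 * (c2 * S)) - \<tau> - c1\<^sup>2 * c3 * (S * S)"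
      using 3 4 by (simp add: \<tau> power2_eq_square algebra_simps)
    then show ?thesis using 1 2 mu unfolding s by linarith
  qed

  have grad: "\<bar>contrast_grad n Z \<beta>s A x $ j\<bar> < lam * rho"
    if x: "support x \<subseteq> \<Gamma>" "norm (x - \<beta>s) \<le> r" and j: "j \<notin> \<Gamma>" for x j
  proof -
    \<comment> \<open>The sample size condition reads \<open>36 * U * C0 \<le> 1\<close>, and \<open>S * r \<le> 2 * C0 * lam * rho\<close>.\<close>
    define U where "U = c5 / sqrt (real n) * (c2\<^sup>2 * S ^ 4)"
    have U0: "0 \<le> U" using c5 by (simp add: U_def)
    have UC: "36 * (U * C0) \<le> 1"
      using sample n unfolding s by (simp add: U_def field_simps power2_eq_square power4_eq_xxxx)
    have "S * r = C0 * (S * L + lam * rho)" using S by (simp add: r field_simps)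
    also have "\<dots> \<le> C0 * (2 * (lam * rho))" using lam_lower(1) C0_pos by (intro mult_left_mono) auto
    finally have "U * (S * r) \<le> U * (C0 * (2 * (lam * rho)))" using U0 by (rule mult_left_mono)
    also have "\<dots> = (36 * (U * C0)) * (lam * rho / 18)" by simp
    also have "\<dots> \<le> 1 * (lam * rho / 18)" using UC lr by (intro mult_right_mono) auto
    finally have USr: "U * (S * r) \<le> lam * rho / 18" by simp
    have h1: "(\<Sum>k\<in>UNIV. \<bar>(x - \<beta>s) $ k\<bar>) \<le> S * r"
      and h2: "(\<Sum>k\<in>UNIV. \<bar>(x + \<beta>s) $ k\<bar>) \<le> S * (29 / 14 * (c2 * S))"
      and h3: "(\<Sum>k\<in>UNIV. \<bar>x $ k\<bar>) \<le> S * (15 / 14 * (c2 * S))"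
      using S norm_l1_le[OF support_diff[OF x(1) supp_\<beta>s], folded S_def]
        norm_l1_le[OF support_add[OF x(1) supp_\<beta>s], folded S_def] norm_l1_le[OF x(1), folded S_def]
        mult_left_mono[OF x(2), of S] mult_left_mono[OF norm_plus(1)[OF x(2)], of S]
        mult_left_mono[OF norm_x(1)[OF x(2)], of S]
      by (auto simp only: intro: order_trans less_imp_le)
    have "\<bar>contrast_grad n Z \<beta>s A x $ j\<bar>
      \<le> (c5 / sqrt (real n) * (S * r) * (S * (29 / 14 * (c2 * S))) + t) * (S * (15 / 14 * (c2 * S)))"
      by (rule order_trans[OF contrast_grad_off_support[OF x(1) j]])
         (intro mult_mono add_mono h1 h2 h3 order_refl add_nonneg_nonneg mult_nonneg_nonneg
            sum_nonneg abs_ge_zero divide_nonneg_nonneg real_sqrt_ge_zero t;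
          use S c2 c5 r_pos in simp)
    also have "\<dots> = 435 / 196 * (U * (S * r)) + 15 / 42 * (3 * c2 * real (card \<Gamma>) * t)"
      unfolding s U_def by (simp add: field_simps power2_eq_square power4_eq_xxxx)
    also have "\<dots> \<le> 435 / 196 * (lam * rho / 18) + 15 / 42 * (lam * rho)"
      using USr lam_lower(2) by (intro add_mono mult_left_mono) auto
    also have "\<dots> < lam * rho" using lr by simp
    finally show ?thesis .
  qed

  have cont: "continuous_on UNIV (contrast n Z \<beta>s p A)"
  proof -
    have "continuous_on UNIV (\<lambda>x :: real ^ 'd. (A, x))" by (intro continuous_intros)
    from continuous_on_compose2[OF continuous_on_contrast[OF pen] this] show ?thesis by simp
  qed
  have "compact K" unfolding K_def
    by (intro closed_Int_compact closed_support_subset compact_cball)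
  moreover have "\<beta>s \<in> K" using supp_\<beta>s r_pos by (simp add: K_def)
  ultimately obtain x0 where x0: "x0 \<in> K" "\<And>z. z \<in> K \<Longrightarrow> contrast n Z \<beta>s p A x0 \<le> contrast n Z \<beta>s p A z"
    using continuous_attains_inf[OF _ _ continuous_on_subset[OF cont]] by (metis empty_iff subset_UNIV)
  have inK: "support x \<subseteq> \<Gamma>" "norm (x - \<beta>s) \<le> r" if "x \<in> K" for x
    using that by (auto simp: K_def dist_norm norm_minus_commute)
  have uniq: "x = z" if x: "x \<in> K" "\<And>w. w \<in> K \<Longrightarrow> contrast n Z \<beta>s p A x \<le> contrast n Z \<beta>s p A w"
    and z: "z \<in> K" "\<And>w. w \<in> K \<Longrightarrow> contrast n Z \<beta>s p A z \<le> contrast n Z \<beta>s p A w" for x z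
  proof (rule ccontr)
    assume "x \<noteq> z"
    define a where "a = (1 / 2) *\<^sub>R (x + z)"
    define e where "e = (1 / 2) *\<^sub>R (x - z)"
    have xz: "x = a + e" "z = a - e"
      by (simp_all add: a_def e_def vec_eq_iff field_simps)
    have ae: "support a \<subseteq> \<Gamma>" "support e \<subseteq> \<Gamma>"
      using inK(1)[OF x(1)] inK(1)[OF z(1)] by (simp_all add: a_def e_def support_scaleR support_add support_diff)
    have "a - \<beta>s = (1 / 2) *\<^sub>R ((x - \<beta>s) + (z - \<beta>s))"
      by (simp add: a_def vec_eq_iff field_simps)
    then have "norm (a - \<beta>s) = 1 / 2 * norm ((x - \<beta>s) + (z - \<beta>s))" by simp
    also have "\<dots> \<le> r"
      using norm_triangle_ineq[of "x - \<beta>s" "z - \<beta>s"] inK(2)[OF x(1)] inK(2)[OF z(1)] by simp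
    finally have a: "norm (a - \<beta>s) \<le> r" .
    then have "a \<in> K" using ae by (simp add: K_def dist_norm norm_minus_commute)
    have "e \<noteq> 0" using \<open>x \<noteq> z\<close> by (simp add: e_def)
    then have "0 < (2 * c3 * (norm a)\<^sup>2 - c4 * norm (a - \<beta>s) * norm (a + \<beta>s) - \<tau> - \<mu>) * (norm e)\<^sup>2"
      using curvature[OF a] by simp
    also have "\<dots> \<le> contrast n Z \<beta>s p A x + contrast n Z \<beta>s p A z - 2 * contrast n Z \<beta>s p A a"
      unfolding xz by (rule contrast_midpoint[OF ae])
    finally show False using x(2)[OF \<open>a \<in> K\<close>] z(2)[OF \<open>a \<in> K\<close>] by linarith
  qed
  show "\<exists>!x. x \<in> K \<and> (\<forall>z\<in>K. contrast n Z \<beta>s p A x \<le> contrast n Z \<beta>s p A z)"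
    by (rule ex1I[of _ x0]) (use x0 uniq in blast)+
  assume x: "x \<in> K" "\<And>z. z \<in> K \<Longrightarrow> contrast n Z \<beta>s p A x \<le> contrast n Z \<beta>s p A z"
  have "norm (x - \<beta>s) \<noteq> r"
    using boundary[OF inK(1)[OF x(1)]] x(2)[OF \<open>\<beta>s \<in> K\<close>] by force
  then have interior: "norm (x - \<beta>s) < r" using inK(2)[OF x(1)] by simp
  show "local_minimizer (contrast n Z \<beta>s p A) x"
    unfolding contrast_def[abs_def]
  proof (rule local_minimizer_of_restricted[OF pen contrast_loss_has_derivative[OF sym symA]
        continuous_on_contrast_grad inK(1)[OF x(1)], where e = "r - norm (x - \<beta>s)"])
    fix z assume z: "support z \<subseteq> \<Gamma>" "dist x z < r - norm (x - \<beta>s)"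
    have "dist \<beta>s z \<le> dist \<beta>s x + dist x z" by (rule dist_triangle)
    then have "z \<in> K" using z by (simp add: K_def dist_norm norm_minus_commute)
    from x(2)[OF this]
    show "contrast_loss n Z \<beta>s A x + penalty p x \<le> contrast_loss n Z \<beta>s A z + penalty p z"
      by (simp add: contrast_def)
  qed (use interior grad[OF inK(1,2)[OF x(1)]] lr in auto)
qed

end

section \<open>Measurability of unique minimizers\<close>

text \<open>The graph of the minimizer is cut out by the closed conditions of minimality, and a function into
  a compact set with closed graph is continuous.\<close>

lemma continuous_on_unique_argmin:
  fixes F :: "'a::euclidean_space \<Rightarrow> 'b::euclidean_space \<Rightarrow> real"
  assumes K: "compact K" and S: "closed S" and F: "continuous_on UNIV (\<lambda>(a, x). F a x)"
    and g: "\<And>a. a \<in> S \<Longrightarrow> g a \<in> K" "\<And>a x. a \<in> S \<Longrightarrow> x \<in> K \<Longrightarrow> F a (g a) \<le> F a x"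
    and uniq: "\<And>a x. a \<in> S \<Longrightarrow> x \<in> K \<Longrightarrow> (\<And>z. z \<in> K \<Longrightarrow> F a x \<le> F a z) \<Longrightarrow> x = g a"
  shows "continuous_on S g"
proof (rule continuous_from_closed_graph[OF K])
  have graph: "(\<lambda>a. (a, g a)) ` S = S \<times> K \<inter> (\<Inter>z\<in>K. {ax. F (fst ax) (snd ax) \<le> F (fst ax) z})" (is "?L = ?R")
  proof
    show "?L \<subseteq> ?R" using g by auto
    show "?R \<subseteq> ?L"
    proof
      fix q assume q: "q \<in> ?R"
      then have "snd q = g (fst q)" by (intro uniq) auto
      then show "q \<in> ?L" using q by (auto simp: image_iff prod_eq_iff)
    qed
  qed
  have le: "closed {ax. F (fst ax) (snd ax) \<le> F (fst ax) z}" for z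
  proof (rule closed_Collect_le)
    show "continuous_on UNIV (\<lambda>ax. F (fst ax) (snd ax))" using F by (simp add: case_prod_beta)
    have "continuous_on UNIV (\<lambda>ax :: 'a \<times> 'b. (fst ax, z))" by (intro continuous_intros)
    from continuous_on_compose2[OF F this]
    show "continuous_on UNIV (\<lambda>ax :: 'a \<times> 'b. F (fst ax) z)" by simp
  qed
  show "closed ((\<lambda>a. (a, g a)) ` S)"
    unfolding graph by (intro closed_Int closed_Times closed_INT ballI S compact_imp_closed[OF K] le)
qed (use g in auto)

section \<open>Finite nets in coordinate subspaces\<close>

text \<open>Coordinates outside \<open>G\<close> are thickened to an interval, so that the open balls of the coordinate
  subspace become sets of positive volume; stretching the coordinates in \<open>G\<close> by \<open>\<rho>\<close> shows that their
  volume scales with the dimension \<open>card G\<close> of the subspace.\<close>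

lemma
  fixes G :: "'d::finite set"
  defines "C \<equiv> \<lambda>\<rho>. {v :: real ^ 'd. norm (\<chi> j. if j \<in> G then v $ j else 0) < \<rho> \<and> (\<forall>j\<in>-G. \<bar>v $ j\<bar> < 1)}"
  shows open_cylinder: "open (C \<rho>)"
    and emeasure_cylinder_scale: "0 < \<rho> \<Longrightarrow> emeasure lborel (C \<rho>) = ennreal (\<rho> ^ card G) * emeasure lborel (C 1)"
    and emeasure_cylinder_pos: "0 < emeasure lborel (C 1)"
    and emeasure_cylinder_finite: "emeasure lborel (C 1) < \<infinity>"
proof -
  show op: "open (C \<rho>)" for \<rho>
  proof -
    have "open {v :: real ^ 'd. norm (\<chi> j. if j \<in> G then v $ j else 0) < \<rho>}"
    proof (intro open_Collect_less continuous_intros continuous_on_vec_lambda)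
      fix j show "continuous_on UNIV (\<lambda>v :: real ^ 'd. if j \<in> G then v $ j else 0)"
        by (cases "j \<in> G") (auto intro!: continuous_intros)
    qed
    moreover have "open {v :: real ^ 'd. \<bar>v $ j\<bar> < 1}" for j
      by (intro open_Collect_less continuous_intros)
    moreover have "C \<rho> = {v :: real ^ 'd. norm (\<chi> j. if j \<in> G then v $ j else 0) < \<rho>}
        \<inter> (\<Inter>j\<in>-G. {v. \<bar>v $ j\<bar> < 1})"
      by (auto simp: C_def)
    ultimately show ?thesis by (simp add: open_Int open_INT)
  qed
  have "C 1 \<noteq> {}"
  proof -
    have "(\<chi> j. if j \<in> G then (0 :: real ^ 'd) $ j else 0) = 0" by (simp add: vec_eq_iff)
    then have "0 \<in> C 1" by (simp add: C_def)
    then show ?thesis by blast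
  qed
  then show "0 < emeasure lborel (C 1)"
  proof (elim ex_in_conv[THEN iffD2, THEN exE])
    fix x assume "x \<in> C 1"
    then obtain e where e: "0 < e" "ball x e \<subseteq> C 1" using op[of 1] open_contains_ball by blast
    have "0 < emeasure lborel (ball x e)"
      using e(1) by (simp add: emeasure_ball unit_ball_vol_pos)
    also have "\<dots> \<le> emeasure lborel (C 1)"
      using e(2) op[of 1] by (intro emeasure_mono) auto
    finally show ?thesis .
  qed
  have "C 1 \<subseteq> cbox (\<chi> j. -1) (\<chi> j. 1)"
  proof
    fix v assume v: "v \<in> C 1"
    have "\<bar>v $ j\<bar> \<le> 1" for j
    proof (cases "j \<in> G")
      case True
      then show ?thesis
        using component_le_norm_cart[of "\<chi> j. if j \<in> G then v $ j else 0" j] v by (simp add: C_def)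
    qed (use v in \<open>auto simp: C_def intro: less_imp_le\<close>)
    then show "v \<in> cbox (\<chi> j. -1) (\<chi> j. 1)"
      by (auto simp: mem_box_cart abs_le_iff minus_le_iff)
  qed
  then have "emeasure lborel (C 1) \<le> emeasure lborel (cbox (\<chi> j. -1) (\<chi> j. 1) :: (real ^ 'd) set)"
    by (intro emeasure_mono) auto
  also have "\<dots> < \<infinity>" by (rule emeasure_lborel_cbox_finite)
  finally show "emeasure lborel (C 1) < \<infinity>" .
  assume \<rho>: "0 < \<rho>"
  define c :: "real ^ 'd \<Rightarrow> real" where "c b = (if \<exists>j\<in>G. b = axis j 1 then \<rho> else 1)" for b
  define T :: "real ^ 'd \<Rightarrow> real ^ 'd" where "T x = 0 + (\<Sum>b\<in>Basis. (c b * (x \<bullet> b)) *\<^sub>R b)" for x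
  have c_axis: "c (axis j 1) = (if j \<in> G then \<rho> else 1)" for j
    by (auto simp: c_def axis_eq_axis)
  have Basis_eq: "(Basis :: (real ^ 'd) set) = (\<lambda>j. axis j 1) ` UNIV"
    by (auto simp: Basis_vec_def)
  have inj: "inj (\<lambda>j. axis j 1 :: real ^ 'd)"
    by (auto simp: inj_def axis_eq_axis)
  have T: "T x $ j = (if j \<in> G then \<rho> else 1) * x $ j" for x j
  proof -
    have "T x $ j = (\<Sum>i\<in>UNIV. c (axis i 1) * x $ i * (axis i 1 :: real ^ 'd) $ j)"
      unfolding T_def Basis_eq by (simp add: sum.reindex[OF inj] inner_axis)
    also have "\<dots> = (\<Sum>i\<in>UNIV. if i = j then c (axis j 1) * x $ j else 0)"
      by (intro sum.cong) (auto simp: axis_def)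
    finally show ?thesis by (simp add: c_axis)
  qed
  have lb: "lborel = density (distr lborel borel T) (\<lambda>_. (\<Prod>b\<in>Basis. \<bar>c b\<bar>))"
    unfolding T_def[abs_def] by (rule lborel_affine_euclidean[of c 0]) (use \<rho> in \<open>auto simp: c_def\<close>)
  have T_meas: "T \<in> borel_measurable lborel"
  proof -
    have "continuous_on UNIV T" unfolding T_def[abs_def] by (intro continuous_intros)
    then have "T \<in> borel_measurable borel" by (rule borel_measurable_continuous_onI)
    then show ?thesis by simp
  qed
  have "(\<Prod>b\<in>Basis. \<bar>c b\<bar>) = (\<Prod>j\<in>UNIV. if j \<in> G then \<rho> else 1)"
    unfolding Basis_eq using \<rho> by (simp add: prod.reindex[OF inj] c_axis abs_of_pos cong: prod.cong)
  also have "\<dots> = \<rho> ^ card G" by (simp add: prod.If_cases)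
  finally have prod_c: "(\<Prod>b\<in>Basis. \<bar>c b\<bar>) = \<rho> ^ card G" .
  have vim: "T -` C \<rho> = C 1"
  proof -
    have "(\<chi> j. if j \<in> G then T x $ j else 0) = \<rho> *\<^sub>R (\<chi> j. if j \<in> G then x $ j else 0)" for x
      by (auto simp: vec_eq_iff T)
    then show ?thesis using \<rho> by (auto simp: C_def T)
  qed
  have "emeasure lborel (C \<rho>) = (\<Prod>b\<in>Basis. \<bar>c b\<bar>) * emeasure (distr lborel borel T) (C \<rho>)"
    by (subst lb) (use op[of \<rho>] in \<open>simp add: emeasure_density_const\<close>)
  also have "\<dots> = ennreal (\<rho> ^ card G) * emeasure lborel (C 1)"
    using op[of \<rho>] T_meas by (simp add: prod_c emeasure_distr vim)
  finally show "emeasure lborel (C \<rho>) = ennreal (\<rho> ^ card G) * emeasure lborel (C 1)" .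
qed

text \<open>Volume comparison: the cylinders of radius \<open>\<delta> / 2\<close> around \<open>\<delta>\<close>-separated points of the unit
  ball are disjoint and lie in the cylinder of radius \<open>1 + \<delta> / 2\<close>.\<close>

lemma separated_card_le:
  fixes G :: "'d::finite set" and N :: "(real ^ 'd) set"
  assumes \<delta>: "0 < \<delta>" and fin: "finite N"
    and N: "\<And>x. x \<in> N \<Longrightarrow> support x \<subseteq> G \<and> norm x \<le> 1"
    and sep: "\<And>x z. x \<in> N \<Longrightarrow> z \<in> N \<Longrightarrow> x \<noteq> z \<Longrightarrow> \<delta> \<le> dist x z"
  shows "real (card N) \<le> (1 + 2 / \<delta>) ^ card G"
proof -
  define P where "P v = (\<chi> j. if j \<in> G then v $ j else 0)" for v :: "real ^ 'd"
  define C where "C \<rho> = {v :: real ^ 'd. norm (P v) < \<rho> \<and> (\<forall>j\<in>-G. \<bar>v $ j\<bar> < 1)}" for \<rho>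
  note cyl = open_cylinder[of G, folded P_def, folded C_def]
    emeasure_cylinder_scale[of _ G, folded P_def, folded C_def]
    emeasure_cylinder_pos[of G, folded P_def, folded C_def]
    emeasure_cylinder_finite[of G, folded P_def, folded C_def]
  define V where "V = measure lborel (C 1)"
  have V: "emeasure lborel (C 1) = ennreal V"
    unfolding V_def by (rule emeasure_eq_ennreal_measure) (use cyl(4) in auto)
  moreover from this have "0 < V" using cyl(3) by simp
  ultimately have V: "emeasure lborel (C 1) = ennreal V" "0 < V" by auto
  have P_add: "P (x + z) = P x + P z" and P_diff: "P (x - z) = P x - P z" for x z
    by (auto simp: P_def vec_eq_iff)
  have P_N: "P x = x" if "x \<in> N" for x
    using N[OF that] by (auto simp: P_def vec_eq_iff support_def)
  have off: "x $ j = 0" if "x \<in> N" "j \<notin> G" for x j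
    using N[OF that(1)] that(2) by (auto simp: support_def)
  have vol: "emeasure lborel ((+) x ` C (\<delta> / 2)) = ennreal ((\<delta> / 2) ^ card G * V)" for x
  proof -
    have "emeasure lborel ((+) x ` C (\<delta> / 2)) = emeasure lborel (C (\<delta> / 2))"
    proof -
      have im: "(\<lambda>v. 1 *\<^sub>R v + x) ` C (\<delta> / 2) = (+) x ` C (\<delta> / 2)" by (auto simp: add.commute)
      have op: "open ((+) x ` C (\<delta> / 2))" using cyl(1) by (rule open_translation)
      have "emeasure lborel ((+) x ` C (\<delta> / 2)) = emeasure lebesgue ((+) x ` C (\<delta> / 2))"
        using op by simp
      also have "\<dots> = emeasure lebesgue (C (\<delta> / 2))"
        using emeasure_lebesgue_affine[of 1 x "C (\<delta> / 2)", unfolded im]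
        by (simp only: abs_one power_one ennreal_1 mult_1)
      also have "\<dots> = emeasure lborel (C (\<delta> / 2))"
        using cyl(1) by simp
      finally show ?thesis .
    qed
    then show ?thesis using \<delta> V cyl(2)[of "\<delta> / 2"] by (simp add: ennreal_mult)
  qed
  have disj: "disjoint_family_on (\<lambda>x. (+) x ` C (\<delta> / 2)) N"
  proof (unfold disjoint_family_on_def, intro ballI impI, rule ccontr)
    fix x z assume xz: "x \<in> N" "z \<in> N" "x \<noteq> z" "(+) x ` C (\<delta> / 2) \<inter> (+) z ` C (\<delta> / 2) \<noteq> {}"
    then obtain u v where uv: "u \<in> C (\<delta> / 2)" "v \<in> C (\<delta> / 2)" "x + u = z + v" by auto
    then have "x + P u = z + P v" using xz P_add[of x u] P_add[of z v] by (simp add: P_N)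
    then have "x = z + P v - P u" by (simp add: eq_diff_eq)
    then have "dist x z = norm (P v - P u)" by (simp add: dist_norm)
    also have "\<dots> < \<delta>" using uv norm_triangle_ineq4[of "P v" "P u"] by (simp add: C_def)
    finally show False using sep[OF xz(1-3)] by simp
  qed
  have "ennreal (real (card N) * ((\<delta> / 2) ^ card G * V)) = (\<Sum>x\<in>N. emeasure lborel ((+) x ` C (\<delta> / 2)))"
    using V \<delta> by (simp add: vol ennreal_mult ennreal_of_nat_eq_real_of_nat)
  also have "\<dots> = emeasure lborel (\<Union>x\<in>N. (+) x ` C (\<delta> / 2))"
    by (rule sum_emeasure[OF _ disj fin]) (use cyl(1) in \<open>auto intro!: open_translation borel_open\<close>)
  also have "\<dots> \<le> emeasure lborel (C (1 + \<delta> / 2))"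
  proof (rule emeasure_mono)
    show "(\<Union>x\<in>N. (+) x ` C (\<delta> / 2)) \<subseteq> C (1 + \<delta> / 2)"
    proof clarify
      fix x v assume x: "x \<in> N" and v: "v \<in> C (\<delta> / 2)"
      have "norm (P (x + v)) \<le> norm x + norm (P v)"
        using P_add[of x v] P_N[OF x] norm_triangle_ineq[of x "P v"] by simp
      moreover have "(x + v) $ j = v $ j" if "j \<notin> G" for j using off[OF x that] by simp
      ultimately show "x + v \<in> C (1 + \<delta> / 2)"
        using v N[OF x] by (auto simp: C_def)
    qed
  qed (use cyl(1) in auto)
  also have "\<dots> = ennreal ((1 + \<delta> / 2) ^ card G * V)"
    using \<delta> V cyl(2)[of "1 + \<delta> / 2"] by (simp add: ennreal_mult)
  finally have "real (card N) * (\<delta> / 2) ^ card G \<le> (1 + \<delta> / 2) ^ card G"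
    using V \<delta> by (subst (asm) ennreal_le_iff) (auto simp: mult.assoc[symmetric])
  then have "real (card N) \<le> (1 + \<delta> / 2) ^ card G / (\<delta> / 2) ^ card G"
    using \<delta> by (simp add: pos_le_divide_eq)
  also have "\<dots> = (1 + 2 / \<delta>) ^ card G"
    using \<delta> by (simp flip: power_divide) (simp add: field_simps)
  finally show ?thesis .
qed

text \<open>A \<open>\<delta>\<close>-separated set of maximal cardinality is a net, as any point far from it could be added.\<close>

lemma finite_net_exists:
  fixes G :: "'d::finite set"
  assumes \<delta>: "0 < \<delta>"
  obtains N :: "(real ^ 'd) set" where "finite N" "real (card N) \<le> (1 + 2 / \<delta>) ^ card G"
    "\<And>x. x \<in> N \<Longrightarrow> support x \<subseteq> G \<and> norm x \<le> 1"
    "\<And>x. support x \<subseteq> G \<Longrightarrow> norm x \<le> 1 \<Longrightarrow> \<exists>z\<in>N. norm (x - z) < \<delta>"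
proof -
  define Q where "Q N \<longleftrightarrow> finite N \<and> (\<forall>x\<in>N. support x \<subseteq> G \<and> norm x \<le> 1) \<and>
     (\<forall>x\<in>N. \<forall>z\<in>N. x \<noteq> z \<longrightarrow> \<delta> \<le> dist x z)" for N :: "(real ^ 'd) set"
  have bound: "card N \<le> nat \<lfloor>(1 + 2 / \<delta>) ^ card G\<rfloor>" if "Q N" for N
    using separated_card_le[OF \<delta>, of N G] that by (auto simp: Q_def le_nat_floor)
  have "Q {}" by (simp add: Q_def)
  obtain N where N: "Q N" "\<And>N'. Q N' \<Longrightarrow> card N' \<le> card N"
    using ex_has_greatest_nat[of Q "{}" card "Suc (nat \<lfloor>(1 + 2 / \<delta>) ^ card G\<rfloor>)", OF \<open>Q {}\<close>] bound
    by (auto simp: less_Suc_eq_le)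
  show ?thesis
  proof (rule that[of N])
    fix x :: "real ^ 'd" assume x: "support x \<subseteq> G" "norm x \<le> 1"
    show "\<exists>z\<in>N. norm (x - z) < \<delta>"
    proof (rule ccontr)
      assume "\<not> ?thesis"
      then have far: "\<delta> \<le> dist x z" if "z \<in> N" for z using that by (auto simp: dist_norm not_less)
      then have "x \<notin> N" using \<delta> by fastforce
      have "Q (insert x N)" using N(1) x far by (auto simp: Q_def dist_commute)
      from N(2)[OF this] \<open>x \<notin> N\<close> N(1) show False by (simp add: Q_def)
    qed
  qed (use N(1) separated_card_le[OF \<delta>, of N G] in \<open>auto simp: Q_def\<close>)
qed

section \<open>Sub-Gaussian tails\<close>

text \<open>Chernoff's bound: by independence the moment generating function of the sum factors, and
  \<open>t = u / (\<sigma>\<^sup>2 * S)\<close> minimizes the resulting exponent.\<close>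

lemma (in prob_space) subgaussian_weighted_sum_tail:
  fixes X :: "'i \<Rightarrow> 'a \<Rightarrow> real"
  assumes ind: "indep_vars (\<lambda>_. borel) X I" and fin: "finite I"
    and sg: "\<And>i. i \<in> I \<Longrightarrow> subgaussian M \<sigma> (X i)"
    and \<sigma>: "0 < \<sigma>" and S: "(\<Sum>i\<in>I. (a i)\<^sup>2) \<le> S" "0 < S" and u: "0 \<le> u"
  shows "prob {\<omega>\<in>space M. u \<le> (\<Sum>i\<in>I. a i * X i \<omega>)} \<le> exp (- (u\<^sup>2 / (2 * \<sigma>\<^sup>2 * S)))"
proof (cases "u = 0")
  case False
  with u have u: "0 < u" by simp
  have [measurable]: "X i \<in> borel_measurable M" if "i \<in> I" for i
    using ind that by (auto simp: indep_vars_def)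
  define t where "t = u / (\<sigma>\<^sup>2 * S)"
  have t: "0 < t" using u \<sigma> S by (simp add: t_def)
  define Y where "Y i \<omega> = exp (t * a i * X i \<omega>)" for i \<omega>
  have prod: "exp (t * (\<Sum>i\<in>I. a i * X i \<omega>)) = (\<Prod>i\<in>I. Y i \<omega>)" for \<omega>
    using fin by (simp add: Y_def sum_distrib_left exp_sum mult.assoc)
  have indY: "indep_vars (\<lambda>_. borel) Y I"
    unfolding Y_def by (rule indep_vars_compose2[OF ind]) simp
  have Yint: "integrable M (Y i)" and Yle: "expectation (Y i) \<le> exp (\<sigma>\<^sup>2 * (t * a i)\<^sup>2 / 2)" if "i \<in> I" for i
    using sg[OF that, unfolded subgaussian_def, THEN spec, of "t * a i"] unfolding Y_def by auto
  have int: "integrable M (\<lambda>\<omega>. \<Prod>i\<in>I. Y i \<omega>)"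
    by (rule indep_vars_integrable[OF fin indY Yint])
  have "expectation (\<lambda>\<omega>. \<Prod>i\<in>I. Y i \<omega>) = (\<Prod>i\<in>I. expectation (Y i))"
    by (rule indep_vars_lebesgue_integral[OF fin indY Yint])
  also have "\<dots> \<le> (\<Prod>i\<in>I. exp (\<sigma>\<^sup>2 * (t * a i)\<^sup>2 / 2))"
    by (intro prod_mono) (auto simp: Yle Y_def intro!: integral_nonneg_AE)
  also have "\<dots> = exp (\<sigma>\<^sup>2 * t\<^sup>2 / 2 * (\<Sum>i\<in>I. (a i)\<^sup>2))"
    using fin by (simp add: exp_sum[symmetric] sum_distrib_left power_mult_distrib mult_ac)
  also have "\<dots> \<le> exp (\<sigma>\<^sup>2 * t\<^sup>2 / 2 * S)" using S by (simp add: mult_left_mono)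
  finally have mgf: "expectation (\<lambda>\<omega>. \<Prod>i\<in>I. Y i \<omega>) \<le> exp (\<sigma>\<^sup>2 * t\<^sup>2 / 2 * S)" .
  have "prob {\<omega>\<in>space M. u \<le> (\<Sum>i\<in>I. a i * X i \<omega>)} = prob {\<omega>\<in>space M. exp (t * u) \<le> (\<Prod>i\<in>I. Y i \<omega>)}"
    using t by (simp flip: prod)
  also have "\<dots> \<le> expectation (\<lambda>\<omega>. \<Prod>i\<in>I. Y i \<omega>) / exp (t * u)"
    by (rule integral_Markov_inequality_measure[OF int, of "{}"]) (auto simp: Y_def prod_nonneg)
  also have "\<dots> \<le> exp (\<sigma>\<^sup>2 * t\<^sup>2 / 2 * S) / exp (t * u)" using mgf by (simp add: divide_right_mono)
  also have "\<dots> = exp (\<sigma>\<^sup>2 * t\<^sup>2 / 2 * S - t * u)" by (simp add: exp_diff)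
  also have "\<sigma>\<^sup>2 * t\<^sup>2 / 2 * S - t * u = - (u\<^sup>2 / (2 * \<sigma>\<^sup>2 * S))"
    using \<sigma> S by (simp add: t_def field_simps power2_eq_square)
  finally show ?thesis .
qed simp

lemma (in prob_space) subgaussian_weighted_sum_tail_abs:
  fixes X :: "'i \<Rightarrow> 'a \<Rightarrow> real"
  assumes ind: "indep_vars (\<lambda>_. borel) X I" and fin: "finite I"
    and sg: "\<And>i. i \<in> I \<Longrightarrow> subgaussian M \<sigma> (X i)"
    and \<sigma>: "0 < \<sigma>" and S: "(\<Sum>i\<in>I. (a i)\<^sup>2) \<le> S" "0 < S" and u: "0 \<le> u"
  shows "prob {\<omega>\<in>space M. u \<le> \<bar>\<Sum>i\<in>I. a i * X i \<omega>\<bar>} \<le> 2 * exp (- (u\<^sup>2 / (2 * \<sigma>\<^sup>2 * S)))"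
proof -
  have [measurable]: "X i \<in> borel_measurable M" if "i \<in> I" for i
    using ind that by (auto simp: indep_vars_def)
  have "prob {\<omega>\<in>space M. u \<le> \<bar>\<Sum>i\<in>I. a i * X i \<omega>\<bar>}
     \<le> prob ({\<omega>\<in>space M. u \<le> (\<Sum>i\<in>I. a i * X i \<omega>)} \<union> {\<omega>\<in>space M. u \<le> (\<Sum>i\<in>I. - a i * X i \<omega>)})"
    by (intro finite_measure_mono) (auto simp: sum_negf)
  also have "\<dots> \<le> prob {\<omega>\<in>space M. u \<le> (\<Sum>i\<in>I. a i * X i \<omega>)} + prob {\<omega>\<in>space M. u \<le> (\<Sum>i\<in>I. - a i * X i \<omega>)}"
    by (intro measure_Un_le) measurable
  also have "\<dots> \<le> exp (- (u\<^sup>2 / (2 * \<sigma>\<^sup>2 * S))) + exp (- (u\<^sup>2 / (2 * \<sigma>\<^sup>2 * S)))"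
    using S by (intro add_mono subgaussian_weighted_sum_tail[OF ind fin sg \<sigma> _ _ u]) auto
  finally show ?thesis by simp
qed

section \<open>Probability of small noise\<close>

text \<open>A symmetric form is controlled by its values on a net: replacing a maximizer by a net point at
  distance \<open>1 / 4\<close> loses at most half of the maximum.\<close>

lemma quadratic_le_of_net:
  fixes A :: "real ^ 'd ^ 'd"
  assumes sym: "transpose A = A"
    and N: "\<And>z. z \<in> N \<Longrightarrow> support z \<subseteq> G \<and> norm z \<le> 1"
    and net: "\<And>x. support x \<subseteq> G \<Longrightarrow> norm x \<le> 1 \<Longrightarrow> \<exists>z\<in>N. norm (x - z) < 1 / 4"
    and small: "\<And>z. z \<in> N \<Longrightarrow> \<bar>z \<bullet> (A *v z)\<bar> \<le> \<tau> / 2"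
    and x: "support x \<subseteq> G"
  shows "\<bar>x \<bullet> (A *v x)\<bar> \<le> \<tau> * (norm x)\<^sup>2"
proof -
  define B where "B = {x :: real ^ 'd. support x \<subseteq> G} \<inter> cball 0 1"
  have "compact B" unfolding B_def
    by (intro closed_Int_compact closed_support_subset compact_cball)
  moreover have "B \<noteq> {}"
  proof -
    have "0 \<in> B" by (simp add: B_def support_def)
    then show ?thesis by blast
  qed
  moreover have "continuous_on B (\<lambda>x. \<bar>x \<bullet> (A *v x)\<bar>)"
    unfolding form_sum by (intro continuous_intros)
  ultimately have "\<exists>w\<in>B. \<forall>x\<in>B. \<bar>x \<bullet> (A *v x)\<bar> \<le> \<bar>w \<bullet> (A *v w)\<bar>"
    by (rule continuous_attains_sup)
  then obtain w where w: "w \<in> B" "\<And>x. x \<in> B \<Longrightarrow> \<bar>x \<bullet> (A *v x)\<bar> \<le> \<bar>w \<bullet> (A *v w)\<bar>"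
    by blast
  define m where "m = \<bar>w \<bullet> (A *v w)\<bar>"
  have quad: "\<bar>x \<bullet> (A *v x)\<bar> \<le> m * (norm x)\<^sup>2" if "support x \<subseteq> G" for x
  proof (cases "x = 0")
    case False
    define a where "a = (1 / norm x) *\<^sub>R x"
    have "a \<in> B" using that False by (simp add: B_def a_def support_scaleR)
    from w(2)[OF this] have "\<bar>a \<bullet> (A *v a)\<bar> \<le> m" by (simp add: m_def)
    moreover have "x \<bullet> (A *v x) = (norm x)\<^sup>2 * (a \<bullet> (A *v a))"
      using False by (simp add: a_def matrix_vector_mult_scaleR power2_eq_square)
    ultimately show ?thesis
      using mult_left_mono[of "\<bar>a \<bullet> (A *v a)\<bar>" m "(norm x)\<^sup>2"] by (simp add: abs_mult mult_ac)
  qed simp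
  have ws: "support w \<subseteq> G" "norm w \<le> 1" using w(1) by (auto simp: B_def)
  obtain z where z: "z \<in> N" "norm (w - z) < 1 / 4" using net[OF ws] by blast
  note zs = N[OF z(1)]
  have "\<bar>w \<bullet> (A *v w) - z \<bullet> (A *v z)\<bar> = \<bar>(w - z) \<bullet> (A *v (w + z))\<bar>"
    by (simp add: form_diff[OF sym])
  also have "\<dots> \<le> m * norm (w - z) * norm (w + z)"
    using ws zs by (intro form_le_of_quadratic_le[OF sym quad] support_diff support_add) auto
  also have "\<dots> \<le> m * (1 / 4) * 2"
    using z(2) ws zs norm_triangle_ineq[of w z] by (intro mult_mono) (auto simp: m_def)
  finally have "m \<le> \<tau>"
    using small[OF z(1)] abs_triangle_ineq2[of "w \<bullet> (A *v w)" "z \<bullet> (A *v z)"] unfolding m_def by linarith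
  then have "m * (norm x)\<^sup>2 \<le> \<tau> * (norm x)\<^sup>2" by (rule mult_right_mono) simp
  then show ?thesis using quad[OF x] by linarith
qed

definition good_noise :: "'d set \<Rightarrow> real \<Rightarrow> real \<Rightarrow> (real ^ 'd ^ 'd) set" where
  "good_noise G \<tau> t = {A. transpose A = A \<and> (\<forall>x. support x \<subseteq> G \<longrightarrow> \<bar>x \<bullet> (A *v x)\<bar> \<le> \<tau> * (norm x)\<^sup>2) \<and>
     (\<forall>j k. \<bar>A $ j $ k\<bar> \<le> t)}"

lemma closed_good_noise: "closed (good_noise G \<tau> t :: (real ^ 'd ^ 'd) set)"
proof -
  have "good_noise G \<tau> t = {A :: real ^ 'd ^ 'd. \<forall>j k. A $ k $ j = A $ j $ k} \<inter>
     {A. \<forall>x. support x \<subseteq> G \<longrightarrow> \<bar>x \<bullet> (A *v x)\<bar> \<le> \<tau> * (norm x)\<^sup>2} \<inter> {A. \<forall>j k. \<bar>A $ j $ k\<bar> \<le> t}"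
    by (auto simp: good_noise_def transpose_def vec_eq_iff)
  moreover have "closed {A :: real ^ 'd ^ 'd. \<forall>j k. A $ k $ j = A $ j $ k}"
    by (intro closed_Collect_all closed_Collect_eq continuous_intros)
  moreover have "closed {A :: real ^ 'd ^ 'd. \<forall>x. support x \<subseteq> G \<longrightarrow> \<bar>x \<bullet> (A *v x)\<bar> \<le> \<tau> * (norm x)\<^sup>2}"
    unfolding form_sum
    by (intro closed_Collect_all closed_Collect_imp open_Collect_const closed_Collect_le continuous_intros)
  moreover have "closed {A :: real ^ 'd ^ 'd. \<forall>j k. \<bar>A $ j $ k\<bar> \<le> t}"
    by (intro closed_Collect_all closed_Collect_le continuous_intros)
  ultimately show ?thesis by (auto intro: closed_Int)
qed

lemma measurable_noise_matrix:
  assumes "\<And>i. i \<in> {1..n} \<Longrightarrow> \<epsilon> i \<in> borel_measurable M"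
  shows "(\<lambda>\<omega>. noise_matrix n Z (\<lambda>i. \<epsilon> i \<omega>)) \<in> borel_measurable M"
  unfolding noise_matrix_def using assms
  by (intro borel_measurable_scaleR borel_measurable_const borel_measurable_sum) auto

text \<open>The first term of the failure probability comes from a \<open>1 / 4\<close>-net of at most \<open>9 ^ card G\<close>
  points, the second one from the entries of the matrix.\<close>

lemma (in prob_space) good_noise_probability:
  fixes Z :: "nat \<Rightarrow> real ^ 'd ^ 'd" and G :: "'d set"
  assumes n: "0 < n" and \<sigma>: "0 < \<sigma>" and errors: "iid_subgaussian_errors M n \<sigma> \<epsilon>"
    and sym: "\<And>i. i \<in> {1..n} \<Longrightarrow> transpose (Z i) = Z i"
    and iso: "restricted_isometry n Z G c3 c4"
    and bound: "(\<Sum>i=1..n. (max_abs_entry (Z i))\<^sup>2) \<le> real n"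
    and \<tau>: "0 \<le> \<tau>" and t: "0 \<le> t"
  shows "1 - 2 * (9 ^ card G * exp (- (real n * \<tau>\<^sup>2 / (8 * \<sigma>\<^sup>2 * c4))))
      - 2 * ((real CARD('d))\<^sup>2 * exp (- (real n * t\<^sup>2 / (2 * \<sigma>\<^sup>2))))
    \<le> prob {\<omega>\<in>space M. noise_matrix n Z (\<lambda>i. \<epsilon> i \<omega>) \<in> good_noise G \<tau> t}"
proof -
  define W where "W \<omega> = noise_matrix n Z (\<lambda>i. \<epsilon> i \<omega>)" for \<omega>
  have ind: "indep_vars (\<lambda>_. borel) \<epsilon> {1..n}" and sg: "\<And>i. i \<in> {1..n} \<Longrightarrow> subgaussian M \<sigma> (\<epsilon> i)"
    using errors by (auto simp: iid_subgaussian_errors_def)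
  have eps [measurable]: "\<epsilon> i \<in> borel_measurable M" if "i \<in> {1..n}" for i
    using ind that unfolding indep_vars_def by blast
  have W [measurable]: "W \<in> borel_measurable M"
    unfolding W_def[abs_def] by (rule measurable_noise_matrix[OF eps])
  have c4: "0 < c4" using iso by (auto simp: restricted_isometry_def)
  obtain N :: "(real ^ 'd) set" where N: "finite N" "real (card N) \<le> (1 + 2 / (1 / 4)) ^ card G"
    "\<And>x. x \<in> N \<Longrightarrow> support x \<subseteq> G \<and> norm x \<le> 1"
    "\<And>x. support x \<subseteq> G \<Longrightarrow> norm x \<le> 1 \<Longrightarrow> \<exists>z\<in>N. norm (x - z) < 1 / 4"
    by (rule finite_net_exists[of "1 / 4" G]) (simp, rule that)
  define E1 where "E1 z = {\<omega>\<in>space M. \<tau> / 2 \<le> \<bar>z \<bullet> (W \<omega> *v z)\<bar>}" for z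
  define E2 where "E2 q = {\<omega>\<in>space M. t \<le> \<bar>W \<omega> $ fst q $ snd q\<bar>}" for q :: "'d \<times> 'd"
  have E1: "prob (E1 z) \<le> 2 * exp (- (real n * \<tau>\<^sup>2 / (8 * \<sigma>\<^sup>2 * c4)))" and E1_sets: "E1 z \<in> events" if z: "z \<in> N" for z
  proof -
    have zs: "support z \<subseteq> G" "norm z \<le> 1" using N(3)[OF z] by auto
    have "1 / real n * (\<Sum>i=1..n. (z \<bullet> (submatrix G G (Z i) *v z))\<^sup>2) \<le> c4 * (norm z)\<^sup>2 * (norm z)\<^sup>2"
      using iso zs by (simp add: restricted_isometry_def)
    also have "\<dots> \<le> c4 * 1 * 1"
      using zs c4 by (intro mult_mono power_le_one) auto
    finally have "(\<Sum>i=1..n. (z \<bullet> (Z i *v z))\<^sup>2) \<le> c4 * real n"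
      using n by (simp add: form_submatrix[OF zs(1) zs(1)] field_simps)
    then have "(\<Sum>i=1..n. (z \<bullet> (Z i *v z))\<^sup>2) / (real n)\<^sup>2 \<le> c4 * real n / (real n)\<^sup>2"
      by (rule divide_right_mono) simp
    then have S: "(\<Sum>i=1..n. (z \<bullet> (Z i *v z) / real n)\<^sup>2) \<le> c4 / real n"
      using n by (simp add: power_divide sum_divide_distrib power2_eq_square)
    have "prob {\<omega>\<in>space M. \<tau> / 2 \<le> \<bar>\<Sum>i=1..n. z \<bullet> (Z i *v z) / real n * \<epsilon> i \<omega>\<bar>}
      \<le> 2 * exp (- ((\<tau> / 2)\<^sup>2 / (2 * \<sigma>\<^sup>2 * (c4 / real n))))"
      by (rule subgaussian_weighted_sum_tail_abs[OF ind _ sg \<sigma> S]) (use c4 n \<tau> in auto)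
    moreover have "(\<tau> / 2)\<^sup>2 / (2 * \<sigma>\<^sup>2 * (c4 / real n)) = real n * \<tau>\<^sup>2 / (8 * \<sigma>\<^sup>2 * c4)"
      using n by (simp add: power_divide field_simps)
    ultimately show "prob (E1 z) \<le> 2 * exp (- (real n * \<tau>\<^sup>2 / (8 * \<sigma>\<^sup>2 * c4)))"
      by (simp add: E1_def W_def noise_matrix_form)
    show "E1 z \<in> events" unfolding E1_def W_def noise_matrix_form by measurable
  qed
  have E2: "prob (E2 q) \<le> 2 * exp (- (real n * t\<^sup>2 / (2 * \<sigma>\<^sup>2)))" and E2_sets: "E2 q \<in> events" for q
  proof -
    obtain j k where q: "q = (j, k)" by (cases q)
    have "(\<Sum>i=1..n. (Z i $ j $ k)\<^sup>2) \<le> (\<Sum>i=1..n. (max_abs_entry (Z i))\<^sup>2)"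
    proof (rule sum_mono)
      fix i show "(Z i $ j $ k)\<^sup>2 \<le> (max_abs_entry (Z i))\<^sup>2"
        using power_mono[OF abs_entry_le_max[of "Z i" j k] abs_ge_zero, of 2] by simp
    qed
    then have "(\<Sum>i=1..n. (Z i $ j $ k)\<^sup>2) / (real n)\<^sup>2 \<le> real n / (real n)\<^sup>2"
      using bound by (intro divide_right_mono) auto
    then have S: "(\<Sum>i=1..n. (Z i $ j $ k / real n)\<^sup>2) \<le> 1 / real n"
      using n by (simp add: power_divide sum_divide_distrib power2_eq_square)
    have "prob {\<omega>\<in>space M. t \<le> \<bar>\<Sum>i=1..n. Z i $ j $ k / real n * \<epsilon> i \<omega>\<bar>}
      \<le> 2 * exp (- (t\<^sup>2 / (2 * \<sigma>\<^sup>2 * (1 / real n))))"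
      by (rule subgaussian_weighted_sum_tail_abs[OF ind _ sg \<sigma> S]) (use n t in auto)
    then show "prob (E2 q) \<le> 2 * exp (- (real n * t\<^sup>2 / (2 * \<sigma>\<^sup>2)))"
      by (simp add: E2_def W_def noise_matrix_entry q mult.commute)
    show "E2 q \<in> events" unfolding E2_def W_def noise_matrix_entry by measurable
  qed
  define Bad where "Bad = (\<Union>z\<in>N. E1 z) \<union> (\<Union>q\<in>UNIV. E2 q)"
  have Bad_sets: "Bad \<in> events" unfolding Bad_def using E1_sets E2_sets N(1) by (intro sets.Un sets.finite_UN) auto
  have "prob (\<Union>z\<in>N. E1 z) \<le> (\<Sum>z\<in>N. prob (E1 z))"
    using E1_sets N(1) by (intro finite_measure_subadditive_finite) auto
  also have "\<dots> \<le> real (card N) * (2 * exp (- (real n * \<tau>\<^sup>2 / (8 * \<sigma>\<^sup>2 * c4))))"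
    using E1 by (rule sum_bounded_above)
  also have "\<dots> \<le> 9 ^ card G * (2 * exp (- (real n * \<tau>\<^sup>2 / (8 * \<sigma>\<^sup>2 * c4))))"
    using N(2) by (intro mult_right_mono) auto
  finally have p1: "prob (\<Union>z\<in>N. E1 z) \<le> \<dots>" .
  have "prob (\<Union>q\<in>UNIV. E2 q) \<le> (\<Sum>q\<in>UNIV. prob (E2 q))"
    using E2_sets by (intro finite_measure_subadditive_finite) auto
  also have "\<dots> \<le> real (card (UNIV :: ('d \<times> 'd) set)) * (2 * exp (- (real n * t\<^sup>2 / (2 * \<sigma>\<^sup>2))))"
    using E2 by (rule sum_bounded_above)
  also have "card (UNIV :: ('d \<times> 'd) set) = CARD('d) * CARD('d)" by simp
  finally have p2: "prob (\<Union>q\<in>UNIV. E2 q) \<le> (real CARD('d))\<^sup>2 * (2 * exp (- (real n * t\<^sup>2 / (2 * \<sigma>\<^sup>2))))"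
    by (simp add: power2_eq_square)
  have "prob Bad \<le> prob (\<Union>z\<in>N. E1 z) + prob (\<Union>q\<in>UNIV. E2 q)"
    unfolding Bad_def using E1_sets E2_sets N(1) by (intro measure_Un_le sets.finite_UN) auto
  then have "1 - 2 * (9 ^ card G * exp (- (real n * \<tau>\<^sup>2 / (8 * \<sigma>\<^sup>2 * c4))))
      - 2 * ((real CARD('d))\<^sup>2 * exp (- (real n * t\<^sup>2 / (2 * \<sigma>\<^sup>2)))) \<le> 1 - prob Bad"
    using p1 p2 by simp
  also have "\<dots> = prob (space M - Bad)" by (rule prob_compl[OF Bad_sets, symmetric])
  also have "\<dots> \<le> prob {\<omega>\<in>space M. W \<omega> \<in> good_noise G \<tau> t}"
  proof (rule finite_measure_mono)
    show "space M - Bad \<subseteq> {\<omega>\<in>space M. W \<omega> \<in> good_noise G \<tau> t}"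
    proof clarify
      fix \<omega> assume \<omega>: "\<omega> \<in> space M" "\<omega> \<notin> Bad"
      have symW: "transpose (W \<omega>) = W \<omega>" unfolding W_def by (rule transpose_noise_matrix[OF sym])
      have net: "\<bar>z \<bullet> (W \<omega> *v z)\<bar> \<le> \<tau> / 2" if "z \<in> N" for z
        using \<omega> that by (force simp: Bad_def E1_def)
      have entry: "\<bar>W \<omega> $ j $ k\<bar> \<le> t" for j k
      proof -
        have "\<omega> \<notin> E2 (j, k)" using \<omega> by (auto simp: Bad_def)
        then show ?thesis using \<omega> by (simp add: E2_def)
      qed
      have "\<bar>x \<bullet> (W \<omega> *v x)\<bar> \<le> \<tau> * (norm x)\<^sup>2" if "support x \<subseteq> G" for x
        by (rule quadratic_le_of_net[OF symW N(3,4) net that])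
      then show "W \<omega> \<in> good_noise G \<tau> t" using symW entry by (simp add: good_noise_def)
    qed
    show "{\<omega>\<in>space M. W \<omega> \<in> good_noise G \<tau> t} \<in> events"
    proof -
      have "{\<omega>\<in>space M. W \<omega> \<in> good_noise G \<tau> t} = W -` good_noise G \<tau> t \<inter> space M" by blast
      then show ?thesis using measurable_sets[OF W borel_closed[OF closed_good_noise]] by simp
    qed
  qed
  finally show ?thesis by (simp add: W_def)
qed

section \<open>Sparse and consistent local minimizers\<close>

lemma norm_signal_bounds:
  assumes "signal_bounds \<beta> c1 c2"
  shows "c1 * sqrt (real (card (support \<beta>))) \<le> norm \<beta>" "norm \<beta> \<le> c2 * sqrt (real (card (support \<beta>)))"
proof -
  have c: "0 < c1" "c1 \<le> c2"
    and coord: "\<And>j. j \<in> support \<beta> \<Longrightarrow> c1 \<le> \<bar>\<beta> $ j\<bar> \<and> \<bar>\<beta> $ j\<bar> \<le> c2"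
    using assms by (auto simp: signal_bounds_def)
  have "(norm \<beta>)\<^sup>2 = (\<Sum>j\<in>UNIV. (\<beta> $ j)\<^sup>2)"
    unfolding power2_norm_eq_inner inner_vec_def by (simp add: power2_eq_square)
  also have "\<dots> = (\<Sum>j\<in>support \<beta>. \<bar>\<beta> $ j\<bar>\<^sup>2)"
    by (auto simp: support_def intro!: sum.mono_neutral_cong_right)
  finally have sq: "(norm \<beta>)\<^sup>2 = (\<Sum>j\<in>support \<beta>. \<bar>\<beta> $ j\<bar>\<^sup>2)" .
  have "(c1 * sqrt (real (card (support \<beta>))))\<^sup>2 = (\<Sum>j\<in>support \<beta>. c1\<^sup>2)"
    by (simp add: power_mult_distrib)
  also have "\<dots> \<le> (norm \<beta>)\<^sup>2" unfolding sq using coord c by (intro sum_mono power_mono) auto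
  finally show "c1 * sqrt (real (card (support \<beta>))) \<le> norm \<beta>" by (rule power2_le_imp_le) simp
  have "(norm \<beta>)\<^sup>2 \<le> (\<Sum>j\<in>support \<beta>. c2\<^sup>2)" unfolding sq using coord by (intro sum_mono power_mono) auto
  also have "\<dots> = (c2 * sqrt (real (card (support \<beta>))))\<^sup>2"
    by (simp add: power_mult_distrib)
  finally show "norm \<beta> \<le> c2 * sqrt (real (card (support \<beta>)))" by (rule power2_le_imp_le) (use c in simp)
qed

theorem theorem2:
  fixes n s :: nat
    and ds :: "nat \<Rightarrow> nat"
    and Z :: "nat \<Rightarrow> real ^ 'd ^ 'd"
    and \<beta>s :: "real ^ 'd"
    and \<Gamma> :: "'d set"
    and M :: "'a measure"
    and \<epsilon> y :: "nat \<Rightarrow> 'a \<Rightarrow> real"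
    and obs :: 'a
    and p :: "real \<Rightarrow> real"
    and lam rho \<mu> \<sigma> c1 c2 c3 c4 c5 C0 r p1 p2 :: real
  assumes prob: "prob_space M"
    and dim: "CARD('d) = ds n" "high_dimensional ds"
    and Gamma: "\<Gamma> = support \<beta>s" and s: "s = card \<Gamma>"
    and sym: "\<And>i. i \<in> {1..n} \<Longrightarrow> transpose (Z i) = Z i"
    and model: "\<And>i \<omega>. i \<in> {1..n} \<Longrightarrow> \<omega> \<in> space M \<Longrightarrow> y i \<omega> = \<beta>s \<bullet> (Z i *v \<beta>s) + \<epsilon> i \<omega>"
    and signal: "signal_bounds \<beta>s c1 c2"
    \<comment> \<open>Centring is a property of the observed sample \<open>y i obs\<close>. Imposed for almost every outcome it
       would contradict the errors being independent with positive variance.\<close>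
    and std: "obs \<in> space M" "standardized n Z (\<lambda>i. y i obs)"
    and lam: "0 < lam"
    and A1: "weakly_convex_concave p \<mu> lam rho"
    and A2: "0 < \<sigma>" "iid_subgaussian_errors M n \<sigma> \<epsilon>"
    and A3: "restricted_isometry n Z \<Gamma> c3 c4"
    and A4: "low_cross_correlation n Z \<Gamma> c5"
    and C0: "C0 = max (10 * \<sigma> * sqrt c4 / (c1 * c3)) (4 / (c1\<^sup>2 * c3))"
    and r: "r = C0 * (sqrt (ln (1 + 2 * real n) / real n) + lam * rho / sqrt (real s))"
    and p1: "p1 = 2 * exp (- (real s * ln (1 + 2 * real n)))"
    and p2: "p2 = real n powr (- (real n / 2))"
    and triple1: "36 * c2\<^sup>2 * c5 * C0 * (real s)\<^sup>2 \<le> sqrt (real n)"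
    and triple2: "sqrt (2 * ln (1 + 2 * real n) / real n) \<le> c2 / C0"
    and triple3: "3 / sqrt (real n * real s) \<le> c2"
    and lam_lower: "max (sqrt (real s * ln (1 + 2 * real n) / real n))
           (6 * sqrt 2 * c2 * \<sigma> * real s *
              sqrt ((real s * ln (1 + 2 * real n) + ln (real CARD('d))) / real n)) \<le> lam * rho"
    and lam_upper: "lam * rho \<le> c2 * sqrt (real s) / (sqrt 2 * C0)"
    and mu: "\<mu> \<le> c1\<^sup>2 * c3 * real s"
    and radius: "2 * (4 * c3 + 3 * c4) * c2 * r
           + 10 * \<sigma> * sqrt c4 * sqrt (ln (1 + 2 * real n) / real n) \<le> c1\<^sup>2 * c3 * sqrt (real s)"
  shows "\<exists>\<beta>h :: 'a \<Rightarrow> real ^ 'd.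
     \<beta>h \<in> borel_measurable M \<and>
     (\<forall>\<omega>\<in>space M. local_minimizer (objective n Z (\<lambda>i. y i \<omega>) p) (\<beta>h \<omega>)) \<and>
     measure M {\<omega>\<in>space M. \<forall>j\<in>-\<Gamma>. \<beta>h \<omega> $ j = 0} \<ge> 1 - p1 - 2 * p2 - 2 / real n \<and>
     measure M {\<omega>\<in>space M. min (norm (\<beta>h \<omega> + \<beta>s)) (norm (\<beta>h \<omega> - \<beta>s)) \<le> r}
       \<ge> 1 - p1 - 2 * p2 - 2 / real n"
proof -
  interpret prob_space M by (rule prob)
  define S where "S = sqrt (real s)"
  define l where "l = ln (1 + 2 * real n)"
  define L where "L = sqrt (l / real n)"
  define q where "q = \<sigma> * sqrt c4"
  define \<kappa> where "\<kappa> = sqrt ((real s * l + ln (real CARD('d))) / real n)"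
  \<comment> \<open>Noise levels: \<open>\<tau>\<close> is \<open>S / 2\<close> times the noise term of the radius condition, and \<open>t\<close> gives the tail
     of an entry the exponent \<open>- 2 * (s * l + ln d)\<close>.\<close>
  define \<tau> where "\<tau> = 5 * q * (S * L)"
  define t where "t = 2 * \<sigma> * \<kappa>"
  have c: "0 < c1" "c1 \<le> c2" using signal by (auto simp: signal_bounds_def)
  have c34: "0 < c3" "c3 \<le> c4" using A3 by (auto simp: restricted_isometry_def)
  have "0 < rho" using A1 unfolding weakly_convex_concave_def by blast
  with lam have lr: "0 < lam * rho" by simp
  \<comment> \<open>For \<open>s = 0\<close> the upper bound on \<open>lam * rho\<close> would be \<open>0\<close>; for \<open>n = 0\<close> the quotient \<open>1 / n\<close> is \<open>0\<close> and the
     restricted isometry would force \<open>\<beta>s = 0\<close>.\<close>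
  have "s \<noteq> 0"
  proof
    assume "s = 0"
    with lam_upper lr show False by simp
  qed
  then have s_pos: "0 < real s" and S: "0 < S" by (auto simp: S_def)
  have S_sq: "S * S = real s" by (simp add: S_def)
  have "n \<noteq> 0"
  proof
    assume "n = 0"
    then have "c3 * (norm \<beta>s)\<^sup>2 * (norm \<beta>s)\<^sup>2 \<le> 0"
      using A3 Gamma by (auto simp: restricted_isometry_def)
    moreover have "\<beta>s \<noteq> 0" using \<open>s \<noteq> 0\<close> s Gamma by (auto simp: support_def)
    ultimately show False using c34 by (simp add: mult_le_0_iff)
  qed
  then have n: "0 < n" by simp
  have l: "0 < l" using n by (simp add: l_def)
  have L: "0 \<le> L" and q: "0 \<le> q" using l c34 A2(1) by (auto simp: L_def q_def)
  have d: "1 \<le> real CARD('d)" by (simp add: Suc_le_eq)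
  then have ln_d: "0 \<le> ln (real CARD('d))" by simp
  have \<kappa>: "0 \<le> \<kappa>" using l ln_d by (simp add: \<kappa>_def)
  have C0_1: "10 * q \<le> C0 * c1 * c3"
  proof -
    have "10 * \<sigma> * sqrt c4 / (c1 * c3) \<le> C0" by (simp add: C0)
    then show ?thesis using c c34 by (simp add: q_def divide_le_eq mult_ac)
  qed
  have C0_2: "4 \<le> C0 * c1\<^sup>2 * c3"
  proof -
    have "4 / (c1\<^sup>2 * c3) \<le> C0" by (simp add: C0)
    then show ?thesis using c c34 by (simp add: divide_le_eq mult_ac)
  qed
  have SL: "S * L \<le> lam * rho"
    using lam_lower by (simp add: S_def L_def l_def flip: real_sqrt_mult)
  have t_le: "3 * c2 * real s * t \<le> lam * rho"
  proof -
    have "3 * c2 * real s * t = 6 * 1 * (c2 * \<sigma> * real s * \<kappa>)" by (simp add: t_def)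
    also have "\<dots> \<le> 6 * sqrt 2 * (c2 * \<sigma> * real s * \<kappa>)"
      using c A2(1) \<kappa> by (intro mult_right_mono mult_left_mono) auto
    also have "\<dots> \<le> lam * rho" using lam_lower by (simp add: \<kappa>_def l_def mult_ac)
    finally show ?thesis .
  qed
  have r_eq: "r = C0 * (L + lam * rho / S)" by (simp add: r L_def l_def S_def)
  have radius': "2 * (4 * c3 + 3 * c4) * c2 * r + 10 * q * L \<le> c1\<^sup>2 * c3 * S"
    using radius by (simp add: q_def L_def l_def S_def mult_ac)
  define K where "K = {x. support x \<subseteq> \<Gamma>} \<inter> cball \<beta>s r"
  define G where "G = good_noise \<Gamma> \<tau> t"
  define F where "F = contrast n Z \<beta>s p"
  have minimizer: "\<exists>!x. x \<in> K \<and> (\<forall>z\<in>K. F A x \<le> F A z)"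
    and local_min: "\<And>x. x \<in> K \<Longrightarrow> (\<And>z. z \<in> K \<Longrightarrow> F A x \<le> F A z) \<Longrightarrow> local_minimizer (F A) x"
    if A: "A \<in> G" for A
  proof -
    have A': "transpose A = A" "\<And>x. support x \<subseteq> \<Gamma> \<Longrightarrow> \<bar>x \<bullet> (A *v x)\<bar> \<le> \<tau> * (norm x)\<^sup>2"
      "\<And>j k. \<bar>A $ j $ k\<bar> \<le> t"
      using A by (auto simp: G_def good_noise_def)
    note * = contrast_unique_local_minimizer[OF n sym Gamma A1 A3 A4 A', folded s, folded S_def,
      OF _ _ S lr q L c norm_signal_bounds[OF signal, folded Gamma, folded s, folded S_def] C0_1 C0_2 r_eq \<tau>_def triple1 SL t_le mu radius',
      folded K_def F_def]
    show "\<exists>!x. x \<in> K \<and> (\<forall>z\<in>K. F A x \<le> F A z)" by (rule *(1))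
    show "\<And>x. x \<in> K \<Longrightarrow> (\<And>z. z \<in> K \<Longrightarrow> F A x \<le> F A z) \<Longrightarrow> local_minimizer (F A) x" by (rule *(2))
  qed
  define g where "g A = (THE x. x \<in> K \<and> (\<forall>z\<in>K. F A x \<le> F A z))" for A
  have g: "g A \<in> K" "\<And>z. z \<in> K \<Longrightarrow> F A (g A) \<le> F A z" if "A \<in> G" for A
    using theI'[OF minimizer[OF that], folded g_def] by auto
  have g_unique: "x = g A" if "A \<in> G" "x \<in> K" "\<And>z. z \<in> K \<Longrightarrow> F A x \<le> F A z" for A x
    using minimizer[OF that(1)] that(2,3) g[OF that(1)] by blast
  have "continuous_on G g"
  proof (rule continuous_on_unique_argmin[where K = K and F = F])
    show "compact K" unfolding K_def
      by (intro closed_Int_compact closed_support_subset compact_cball)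
    show "closed G" unfolding G_def by (rule closed_good_noise)
    show "continuous_on UNIV (\<lambda>(a, x). F a x)" unfolding F_def by (rule continuous_on_contrast[OF A1])
  qed (use g g_unique in auto)
  moreover have "G \<in> sets borel" unfolding G_def using closed_good_noise by (rule borel_closed)
  ultimately have select: "(\<lambda>A. if A \<in> G then g A else 0) \<in> borel_measurable borel"
    by (intro borel_measurable_continuous_on_if) auto
  define W where "W \<omega> = noise_matrix n Z (\<lambda>i. \<epsilon> i \<omega>)" for \<omega>
  have "indep_vars (\<lambda>_. borel) \<epsilon> {1..n}" using A2(2) by (simp add: iid_subgaussian_errors_def)
  then have W: "W \<in> borel_measurable M"
    unfolding W_def[abs_def] by (intro measurable_noise_matrix) (simp add: indep_vars_def)
  define \<beta>h where "\<beta>h \<omega> = (if W \<omega> \<in> G then g (W \<omega>) else 0)" for \<omega>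
  have \<beta>h: "\<beta>h \<in> borel_measurable M"
    unfolding \<beta>h_def[abs_def] using measurable_compose[OF W select] by simp
  have loc: "local_minimizer (objective n Z (\<lambda>i. y i \<omega>) p) (\<beta>h \<omega>)" if "\<omega> \<in> space M" for \<omega>
  proof -
    have "local_minimizer (F (W \<omega>)) (\<beta>h \<omega>)"
    proof (cases "W \<omega> \<in> G")
      case True
      then show ?thesis using local_min[OF True g[OF True]] by (simp add: \<beta>h_def)
    next
      case False
      have "transpose (W \<omega>) = W \<omega>" unfolding W_def by (rule transpose_noise_matrix[OF sym])
      then show ?thesis
        using local_minimizer_zero[OF A1 lr sym] False by (simp add: \<beta>h_def F_def)
    qed
    moreover have "objective n Z (\<lambda>i. y i \<omega>) p x = contrast n Z \<beta>s p (noise_matrix n Z (\<lambda>i. \<epsilon> i \<omega>)) x +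
        (1 / (4 * real n) * (\<Sum>i=1..n. (\<epsilon> i \<omega>)\<^sup>2) + 1 / 2 * (\<beta>s \<bullet> (noise_matrix n Z (\<lambda>i. \<epsilon> i \<omega>) *v \<beta>s)))" for x
      by (rule objective_eq_contrast) (rule model[OF _ that])
    ultimately show ?thesis
      by (simp add: local_minimizer_def F_def W_def)
  qed
  have in_K: "\<beta>h \<omega> \<in> K" if "W \<omega> \<in> G" for \<omega> using g(1)[OF that] that by (simp add: \<beta>h_def)
  have good: "1 - p1 - 2 * p2 - 2 / real n \<le> prob {\<omega>\<in>space M. W \<omega> \<in> G}"
  proof -
    have exp_l: "exp l = 1 + 2 * real n" using n by (simp add: l_def)
    have "real n * \<tau>\<^sup>2 / (8 * \<sigma>\<^sup>2 * c4) = 25 / 8 * (real s * l)"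
    proof -
      have "\<tau>\<^sup>2 = 25 * (\<sigma>\<^sup>2 * c4) * (real s * (l / real n))"
        using c34 l by (simp add: \<tau>_def q_def S_def L_def power_mult_distrib)
      then show ?thesis using n c34 A2(1) by simp
    qed
    \<comment> \<open>The size of the net is absorbed by two of the three multiples of \<open>s * l\<close> in the exponent,
       because \<open>9 \<le> (1 + 2 * n)\<^sup>2\<close>.\<close>
    then have "9 ^ s * exp (- (real n * \<tau>\<^sup>2 / (8 * \<sigma>\<^sup>2 * c4))) \<le> (exp (2 * l)) ^ s * exp (- (3 * (real s * l)))"
    proof (simp only:, intro mult_mono power_mono)
      have "exp (2 * l) = (1 + 2 * real n)\<^sup>2"
        by (simp add: exp_double exp_l)
      moreover have "3\<^sup>2 \<le> (1 + 2 * real n)\<^sup>2" using n by (intro power_mono) auto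
      ultimately show "9 \<le> exp (2 * l)" by simp
    qed (use l in auto)
    also have "\<dots> = exp (- (real s * l))" by (simp flip: exp_of_nat_mult exp_add)
    finally have net: "9 ^ s * exp (- (real n * \<tau>\<^sup>2 / (8 * \<sigma>\<^sup>2 * c4))) \<le> exp (- (real s * l))" .
    have "real n * t\<^sup>2 / (2 * \<sigma>\<^sup>2) = 2 * (real s * l) + 2 * ln (real CARD('d))"
    proof -
      have "t\<^sup>2 = 4 * \<sigma>\<^sup>2 * ((real s * l + ln (real CARD('d))) / real n)"
        using l ln_d by (simp add: t_def \<kappa>_def power_mult_distrib)
      then show ?thesis using n A2(1) by (simp add: field_simps)
    qed
    then have "(real CARD('d))\<^sup>2 * exp (- (real n * t\<^sup>2 / (2 * \<sigma>\<^sup>2)))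
      = (real CARD('d))\<^sup>2 * exp (- (2 * (real s * l)) - 2 * ln (real CARD('d)))" by simp
    also have "\<dots> = exp (- (2 * (real s * l)))"
      using d by (simp add: exp_diff exp_double)
    also have "\<dots> \<le> exp (- l)"
    proof -
      have "1 * l \<le> real s * l" using \<open>s \<noteq> 0\<close> l by (intro mult_right_mono) auto
      then show ?thesis using l by simp
    qed
    also have "\<dots> \<le> 1 / real n" using n by (simp add: exp_minus exp_l field_simps)
    finally have entries: "(real CARD('d))\<^sup>2 * exp (- (real n * t\<^sup>2 / (2 * \<sigma>\<^sup>2))) \<le> 1 / real n" .
    have "0 \<le> p2" by (simp add: p2)
    moreover have "1 - 2 * (9 ^ s * exp (- (real n * \<tau>\<^sup>2 / (8 * \<sigma>\<^sup>2 * c4))))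
        - 2 * ((real CARD('d))\<^sup>2 * exp (- (real n * t\<^sup>2 / (2 * \<sigma>\<^sup>2)))) \<le> prob {\<omega>\<in>space M. W \<omega> \<in> G}"
      unfolding W_def G_def s
      by (rule good_noise_probability[OF n A2 sym A3])
         (use std q S L A2(1) \<kappa> in \<open>auto simp: standardized_def \<tau>_def t_def\<close>)
    ultimately show ?thesis using net entries by (simp add: p1 l_def)
  qed
  have supported: "\<beta>h \<omega> $ j = 0" if "j \<notin> \<Gamma>" for \<omega> j
    using in_K[of \<omega>] that by (cases "W \<omega> \<in> G") (auto simp: K_def support_def \<beta>h_def)
  have close: "min (norm (\<beta>h \<omega> + \<beta>s)) (norm (\<beta>h \<omega> - \<beta>s)) \<le> r" if "W \<omega> \<in> G" for \<omega>
    using in_K[OF that] by (simp add: K_def dist_norm norm_minus_commute min.coboundedI2)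
  show ?thesis
  proof (intro exI[of _ \<beta>h] conjI ballI \<beta>h loc)
    have "{\<omega>\<in>space M. \<forall>j\<in>-\<Gamma>. \<beta>h \<omega> $ j = 0} = space M" using supported by auto
    then have "prob {\<omega>\<in>space M. \<forall>j\<in>-\<Gamma>. \<beta>h \<omega> $ j = 0} = 1" by (simp only: prob_space)
    then show "1 - p1 - 2 * p2 - 2 / real n \<le> prob {\<omega>\<in>space M. \<forall>j\<in>-\<Gamma>. \<beta>h \<omega> $ j = 0}"
      using good prob_le_1[of "{\<omega>\<in>space M. W \<omega> \<in> G}"] by linarith
    have "prob {\<omega>\<in>space M. W \<omega> \<in> G} \<le> prob {\<omega>\<in>space M. min (norm (\<beta>h \<omega> + \<beta>s)) (norm (\<beta>h \<omega> - \<beta>s)) \<le> r}"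
    proof (rule finite_measure_mono)
      show "{\<omega>\<in>space M. W \<omega> \<in> G} \<subseteq> {\<omega>\<in>space M. min (norm (\<beta>h \<omega> + \<beta>s)) (norm (\<beta>h \<omega> - \<beta>s)) \<le> r}"
        using close by auto
      show "{\<omega>\<in>space M. min (norm (\<beta>h \<omega> + \<beta>s)) (norm (\<beta>h \<omega> - \<beta>s)) \<le> r} \<in> events"
        using \<beta>h by measurable
    qed
    then show "1 - p1 - 2 * p2 - 2 / real n
      \<le> prob {\<omega>\<in>space M. min (norm (\<beta>h \<omega> + \<beta>s)) (norm (\<beta>h \<omega> - \<beta>s)) \<le> r}"
      using good by linarith
  qed
qed

end
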